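(* Let $n\ge 2$, let $(k_1,\alpha_1),\dots,(k_n,\alpha_n)$ be an admissible sequence and let $\Sigma_n\in\mathbb{R}^{n\times n}$ be the asymptotic covariance matrix in the supercritical regime. With $a_i=\frac{k_i!}{\mu_{k_i}^{(\alpha_i)}}$ for $i\in\{1,\dots,n\}$, the eigenvalues of $\Sigma_n$ are $\lambda_1=0$ and $\lambda_2=\sum_{i=1}^n \frac{1}{a_i^2}$. Moreover, let $$v_1=\Big(\tfrac{a_1}{a_2},-1,0,\dots,0\Big)^t,\ \dots,\ v_{n-1}=\Big(\tfrac{a_1}{a_n},0,\dots,0,-1\Big)^t,\qquad v_n=\Big(\tfrac{a_n}{a_1},\tfrac{a_n}{a_2},\dots,1\Big)^t,$$ that is, for $1\le i\le n-1$ the vector $v_i$ has first entry $a_1/a_{i+1}$, $(i+1)$-st entry $-1$ and all other entries $0$, and $v_n$ has $j$-th entry $a_n/a_j$. Then the eigenspaces of $\Sigma_n$ are $$\mathrm{eig}(\Sigma_n,\lambda_1)=\langle v_1,\dots,v_{n-1}\rangle\quad\text{and}\quad \mathrm{eig}(\Sigma_n,\lambda_2)=\langle v_n\rangle .$$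
   Context: Fix $d\ge 1$ and let $B^d\subset\mathbb{R}^d$ be the unit ball. For $s>0$ and points $x_0,\dots,x_k\in\mathbb{R}^d$ with $k\le d$, $\Delta_s[x_0,\dots,x_k]$ is the $k$-dimensional volume of the convex hull of $x_0,\dots,x_k$ if all edge lengths $\|x_i-x_j\|$ are at most $s$, and $0$ otherwise; for $k>d$ the volume is replaced by $1$. Powers $\Delta_s[\cdot]^\alpha$ are understood to be $0$ when some edge length exceeds $s$. The list $\{x_l\}_{l=i}^j$ stands for $x_i,\dots,x_j$ (empty if $j<i$). Define $$\mu_k^{(\alpha)}=\int_{(B^d)^k}\Delta_1[0,\{x_l\}_{l=1}^k]^\alpha\,dx_1\cdots dx_k,$$ $$\mu_{k_1,k_2:m}^{(\alpha_1,\alpha_2)}=\int_{(B^d)^{k_1+k_2+1-m}}\Delta_1[0,\{x_l\}_{l=1}^{k_1}]^{\alpha_1}\,\Delta_1[0,\{x_l\}_{l=k_1-m+2}^{k_1+k_2-m+1}]^{\alpha_2}\,dx_1\cdots dx_{k_1+k_2+1-m}.$$ A sequence $(k_1,\alpha_1),\dots,(k_n,\alpha_n)$ (with $k_i$ integers, $\alpha_i$ real) is admissible if: $0\le k_1\le\dots\le k_n$; the pairs are distinct; $\alpha_i>-d+k_i-1$ and $\alpha_i+\alpha_j>-d+\min_{l\in\{i,j\}}k_l-1$ for all $i,j$; and $\alpha_i=0$ if $k_i>d$. In the supercritical regime ($t\delta_t^d\to\infty$) the asymptotic covariance matrix of the normalized vector of volume power functionals $(\tilde{\mathcal V}_{k_1}^{(\alpha_1)},\dots,\tilde{\mathcal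 V}_{k_n}^{(\alpha_n)})$ is $$\Sigma_n=\Big(\frac{\mu_{k_i,k_j:1}^{(\alpha_i,\alpha_j)}}{k_i!\,k_j!}\Big)_{i,j=1,\dots,n}.$$ $\langle\cdot\rangle$ denotes linear span and $\mathrm{eig}(\Sigma_n,\lambda)$ the eigenspace of $\Sigma_n$ for $\lambda$. *)

theory Defs
  imports
    "HOL-Analysis.Analysis"
    "Jordan_Normal_Form.Char_Poly"
    "Jordan_Normal_Form.VS_Connect"
begin

text \<open>
  For a finite orthonormal set \<open>B\<close>, this is Lebesgue measure of dimension \<open>card B\<close> on the affine
  subspace \<open>p + span B\<close>, viewed as a measure on the ambient space.  The construction is the one
  by which the library builds \<open>lborel\<close> from \<open>Basis\<close>.
\<close>
definition flat_lborel :: "'a::euclidean_space \<Rightarrow> 'a set \<Rightarrow> 'a measure" where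
  "flat_lborel p B =
     distr (\<Pi>\<^sub>M b\<in>B. (lborel :: real measure)) borel (\<lambda>c. p + (\<Sum>b\<in>B. c b *\<^sub>R b))"

definition orthonormal_set :: "'a::euclidean_space set \<Rightarrow> bool" where
  "orthonormal_set B \<longleftrightarrow> finite B \<and> pairwise Linear_Algebra.orthogonal B \<and> (\<forall>b\<in>B. norm b = 1)"

text \<open>
  The \<open>k\<close>-dimensional volume of a set contained in some \<open>k\<close>-dimensional affine subspace.  By
  invariance of Lebesgue measure under isometries all choices of \<open>p\<close> and \<open>B\<close> give the same value;
  if the affine hull of \<open>S\<close> has dimension less than \<open>k\<close>, this value is \<open>0\<close>.
\<close>
definition flat_volume :: "nat \<Rightarrow> 'a::euclidean_space set \<Rightarrow> real" where
  "flat_volume k S =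
     (SOME v. \<exists>p B. orthonormal_set B \<and> card B = k \<and> S \<subseteq> (\<lambda>y. p + y) ` span B \<and>
        v = measure (flat_lborel p B) S)"

text \<open>
  Points \<open>x\<^sub>0, \<dots>, x\<^sub>k\<close> are given as a list of length \<open>k + 1\<close>.
\<close>
definition short_edges :: "real \<Rightarrow> 'a::euclidean_space list \<Rightarrow> bool" where
  "short_edges s xs \<longleftrightarrow> (\<forall>x\<in>set xs. \<forall>y\<in>set xs. norm (x - y) \<le> s)"

definition Delta :: "real \<Rightarrow> 'a::euclidean_space list \<Rightarrow> real" where
  "Delta s xs =
     (let k = length xs - 1 in
      if short_edges s xs
      then (if k \<le> DIM('a) then flat_volume k (convex hull set xs) else 1)
      else 0)"

text \<open>
  The power is \<open>0\<close> if some edge is too long, for every exponent \<open>\<alpha>\<close>.  Otherwise \<open>\<alpha> = 0\<close> gives \<open>1\<close>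
  also for degenerate simplices, whereas \<open>0 powr 0 = 0\<close> in the library.
\<close>
definition Delta_pow :: "real \<Rightarrow> real \<Rightarrow> 'a::euclidean_space list \<Rightarrow> real" where
  "Delta_pow s \<alpha> xs =
     (if short_edges s xs then (if \<alpha> = 0 then 1 else Delta s xs powr \<alpha>) else 0)"

text \<open>
  A point of \<open>(B\<^sup>d)\<^sup>N\<close> is a function \<open>x\<close> on the index set \<open>{1..N}\<close>.  The list \<open>x\<^sub>i, \<dots>, x\<^sub>j\<close> is
  \<open>map x [i..<j + 1]\<close>.
\<close>
definition ball_power :: "nat \<Rightarrow> (nat \<Rightarrow> 'a::euclidean_space) set" where
  "ball_power N = (\<Pi>\<^sub>E l\<in>{1..N}. cball 0 1)"

definition mu :: "'a::euclidean_space itself \<Rightarrow> nat \<Rightarrow> real \<Rightarrow> real" where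
  "mu _ k \<alpha> =
     (LINT x:ball_power k|(\<Pi>\<^sub>M l\<in>{1..k}. (lborel :: 'a measure)).
        Delta_pow 1 \<alpha> (0 # map x [1..<k + 1]))"

text \<open>
  Sums precede subtractions in the indices so that truncated subtraction does no harm for
  \<open>1 \<le> m \<le> min k\<^sub>1 k\<^sub>2 + 1\<close>.
\<close>
definition mu2 ::
  "'a::euclidean_space itself \<Rightarrow> nat \<Rightarrow> nat \<Rightarrow> nat \<Rightarrow> real \<Rightarrow> real \<Rightarrow> real" where
  "mu2 _ k\<^sub>1 k\<^sub>2 m \<alpha>\<^sub>1 \<alpha>\<^sub>2 =
     (LINT x:ball_power (k\<^sub>1 + k\<^sub>2 + 1 - m)|
         (\<Pi>\<^sub>M l\<in>{1..k\<^sub>1 + k\<^sub>2 + 1 - m}. (lborel :: 'a measure)).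
        Delta_pow 1 \<alpha>\<^sub>1 (0 # map x [1..<k\<^sub>1 + 1]) *
        Delta_pow 1 \<alpha>\<^sub>2 (0 # map x [k\<^sub>1 + 2 - m..<(k\<^sub>1 + k\<^sub>2 + 1 - m) + 1]))"

text \<open>
  Sequences and matrices are indexed by \<open>0, \<dots>, n - 1\<close>.  The second growth condition includes the
  case \<open>i = j\<close>.
\<close>
definition admissible :: "nat \<Rightarrow> nat \<Rightarrow> (nat \<Rightarrow> nat) \<Rightarrow> (nat \<Rightarrow> real) \<Rightarrow> bool" where
  "admissible d n k \<alpha> \<longleftrightarrow>
     mono_on {..<n} k \<and>
     inj_on (\<lambda>i. (k i, \<alpha> i)) {..<n} \<and>
     (\<forall>i<n. \<alpha> i > - real d + real (k i) - 1) \<and>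
     (\<forall>i<n. \<forall>j<n. \<alpha> i + \<alpha> j > - real d + real (min (k i) (k j)) - 1) \<and>
     (\<forall>i<n. k i > d \<longrightarrow> \<alpha> i = 0)"

definition Sigma_supercritical ::
  "'a::euclidean_space itself \<Rightarrow> nat \<Rightarrow> (nat \<Rightarrow> nat) \<Rightarrow> (nat \<Rightarrow> real) \<Rightarrow> real Matrix.mat" where
  "Sigma_supercritical T n k \<alpha> =
     Matrix.mat n n (\<lambda>(i, j). mu2 T (k i) (k j) 1 (\<alpha> i) (\<alpha> j) / (fact (k i) * fact (k j)))"

definition eigenspace :: "real Matrix.mat \<Rightarrow> real \<Rightarrow> real Matrix.vec set" where
  "eigenspace A l = {v \<in> carrier_vec (dim_row A). A *\<^sub>v v = l \<cdot>\<^sub>v v}"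

abbreviation vec_lin_span :: "nat \<Rightarrow> real Matrix.vec set \<Rightarrow> real Matrix.vec set" where
  "vec_lin_span n S \<equiv> LinearCombinations.module.span class_ring (module_vec TYPE(real) n) S"

end

(*
  With m = 1 the two simplices in mu2 share only the vertex 0, so the integral factorises and the
  covariance matrix is u u^T with u_i = 1 / a_i; the spectrum of a rank one matrix is elementary.
  What needs work is that every u_i is finite and nonzero, because the Bochner integral of a
  nonintegrable function is 0.  The k-volume of the simplex 0, x_1, ..., x_k is a positive constant
  times the product of the norms of the Gram--Schmidt vectors of x_1, ..., x_k.  The norm of the
  j-th one dominates |x_j . e_i| for d - j + 1 orthonormal vectors e_i orthogonal to the preceding
  points, so its power beta <= 0 is at most the product of the |x_j . e_i| to the power
  gamma = beta / (d - j + 1), and gamma > -1 makes this integrable over the ball.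
*)
theory Submission
  imports Defs
begin

section \<open>Spectrum of a rank one matrix\<close>

no_notation inner (infix "\<bullet>" 70)
no_notation vec_nth (infixl "$" 90)

text \<open>The volume inside \<open>Delta\<close> is a choice (\<open>SOME\<close>) among all base
  points and orthonormal sets whose flat contains the simplex. Until all choices are known to agree,
  nothing about the integrand of \<open>mu\<close> is accessible, not even its measurability. For a
  degenerate simplex the flat is not unique, so the agreement has to cover that case as well. It is
  obtained by measuring one prism of full dimension over the simplex in two ways: in coordinates of
  an orthonormal frame it is a product of the flat simplex with a unit cube, and in coordinates
  along the edges at 0 it is a linear image of a fixed set. The determinant of the second
  description is the product of the Gram--Schmidt norms, and no case distinction on linear
  dependence arises. The integral estimate serves twice. For a negative exponent it bounds the
  moment. For the exponent -1/2, read with the value \<infinity> at 0, it shows that almost all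
  simplices with k \<le> d are nondegenerate, which gives positivity for every exponent.\<close>

lemma submodule_vecI:
  fixes N :: "real Matrix.vec set"
  assumes "N \<subseteq> carrier_vec n" "0\<^sub>v n \<in> N" "\<And>v w. v \<in> N \<Longrightarrow> w \<in> N \<Longrightarrow> v + w \<in> N"
    "\<And>c v. v \<in> N \<Longrightarrow> c \<cdot>\<^sub>v v \<in> N"
  shows "LinearCombinations.submodule class_ring N (module_vec TYPE(real) n)"
  by (rule LinearCombinations.submodule.intro[OF vec_module])
     (use assms in \<open>auto simp: module_vec_simps class_ring_simps\<close>)

lemma vec_lin_span_subset:
  assumes "W \<subseteq> N" "LinearCombinations.submodule class_ring N (module_vec TYPE(real) n)"
  shows "vec_lin_span n W \<subseteq> N"
  using LinearCombinations.module.span_is_subset[OF vec_module assms] .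

lemma vec_lin_span_closed:
  assumes W: "W \<subseteq> carrier_vec n"
  shows "W \<subseteq> vec_lin_span n W" "0\<^sub>v n \<in> vec_lin_span n W"
    "\<And>v w. v \<in> vec_lin_span n W \<Longrightarrow> w \<in> vec_lin_span n W \<Longrightarrow> v + w \<in> vec_lin_span n W"
    "\<And>c v. v \<in> vec_lin_span n W \<Longrightarrow> c \<cdot>\<^sub>v v \<in> vec_lin_span n W"
proof -
  have W': "W \<subseteq> carrier (module_vec TYPE(real) n)" 
    using W by (simp add: module_vec_simps)
  note sub = LinearCombinations.module.span_is_submodule[OF vec_module W']
  show "W \<subseteq> vec_lin_span n W"
    by (rule LinearCombinations.module.in_own_span[OF vec_module W'])
  show "0\<^sub>v n \<in> vec_lin_span n W"
    using LinearCombinations.submodule.zero_closed[OF sub] by (simp add: module_vec_simps)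
  show "v + w \<in> vec_lin_span n W" if "v \<in> vec_lin_span n W" "w \<in> vec_lin_span n W" for v w
    using LinearCombinations.submodule.m_closed[OF sub that] by (simp add: module_vec_simps)
  show "c \<cdot>\<^sub>v v \<in> vec_lin_span n W" if "v \<in> vec_lin_span n W" for c v
    using LinearCombinations.submodule.smult_closed[OF sub _ that, of c] 
    by (simp add: module_vec_simps class_ring_simps)
qed

lemma eigenspace_submodule:
  assumes "A \<in> carrier_mat n n"
  shows "LinearCombinations.submodule class_ring (eigenspace A l) (module_vec TYPE(real) n)"
  using assms
  by (intro submodule_vecI)
     (auto simp: eigenspace_def mult_add_distrib_mat_vec smult_add_distrib_vec mult_mat_vec
        smult_smult_assoc mult.commute)

lemma eigenvalue_iff_eigenspace:
  assumes "A \<in> carrier_mat n n"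
  shows "eigenvalue A l \<longleftrightarrow> (\<exists>v\<in>eigenspace A l. v \<noteq> 0\<^sub>v n)"
  using assms by (auto simp: eigenvalue_def eigenvector_def eigenspace_def)

text \<open>\<open>A\<close> maps x to u scaled by the pairing of u with x. Hence the kernel is the
  hyperplane orthogonal to u, and an eigenvector for a nonzero eigenvalue is a multiple of u, as
  \<open>z\<close> is; this forces the eigenvalue to be the squared norm of u.\<close>

lemma rank_one_spectrum:
  fixes u :: "nat \<Rightarrow> real" and n :: nat
  defines "A \<equiv> Matrix.mat n n (\<lambda>(i, j). u i * u j)"
  assumes n: "n \<ge> 2" and u: "\<And>i. i < n \<Longrightarrow> u i \<noteq> 0"
    and w: "\<And>i. 1 \<le> i \<Longrightarrow> i \<le> n - 1 \<Longrightarrow>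
      w i = Matrix.vec n (\<lambda>j. if j = 0 then u i / u 0 else if j = i then - 1 else 0)"
    and z: "z = Matrix.vec n (\<lambda>j. u j / u (n - 1))"
  shows "{l. eigenvalue A l} = {0, \<Sum>i<n. (u i)\<^sup>2}"
    and "eigenspace A 0 = vec_lin_span n {w i |i. i \<in> {1..n - 1}}"
    and "eigenspace A (\<Sum>i<n. (u i)\<^sup>2) = vec_lin_span n {z}"
proof -
  define m where "m = (\<Sum>i<n. (u i)\<^sup>2)"
  have m: "m > 0"
    unfolding m_def using u n by (intro sum_pos2[of _ 0]) auto
  have A: "A \<in> carrier_mat n n"
    by (simp add: A_def)
  have mem: "x \<in> eigenspace A l \<longleftrightarrow>
      x \<in> carrier_vec n \<and> (\<forall>i<n. u i * (\<Sum>j<n. u j * x $ j) = l * x $ i)" for x l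
  proof (cases "x \<in> carrier_vec n")
    case True
    then have "(A *\<^sub>v x) $ i = u i * (\<Sum>j<n. u j * x $ j)" if "i < n" for i
      using that by (simp add: A_def scalar_prod_def sum_distrib_left mult.assoc lessThan_atLeast0)
    then show ?thesis
      using True A by (auto simp: eigenspace_def Matrix.vec_eq_iff)
  qed (use A in \<open>auto simp: eigenspace_def\<close>)
  have w_carrier: "{w i |i. i \<in> {1..n - 1}} \<subseteq> carrier_vec n"
    using w by auto
  have z_carrier: "{z} \<subseteq> carrier_vec n"
    using z by auto
  have w_orth: "(\<Sum>j<n. u j * w i $ j) = 0" if i: "i \<in> {1..n - 1}" for i
  proof -
    have "(\<Sum>j<n. u j * w i $ j) = (\<Sum>j<n. (if j = 0 then u i else 0) - (if j = i then u i else 0))"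
      using i w[of i] n u[of 0] by (intro sum.cong) auto
    also have "\<dots> = 0"
    proof -
      have "i < n"
        using i n by auto
      then show ?thesis
        using n by (simp add: sum_subtractf)
    qed
    finally show ?thesis .
  qed
  have w_eig: "w i \<in> eigenspace A 0" if i: "i \<in> {1..n - 1}" for i
    using w_orth[OF i] i w[of i] by (auto simp: mem)
  have z_eig: "z \<in> eigenspace A m"
  proof -
    have "(\<Sum>j<n. u j * z $ j) = m / u (n - 1)"
      by (simp add: z m_def sum_divide_distrib power2_eq_square)
    then show ?thesis
      using z by (auto simp: mem)
  qed
  show "eigenspace A 0 = vec_lin_span n {w i |i. i \<in> {1..n - 1}}"
  proof
    show "vec_lin_span n {w i |i. i \<in> {1..n - 1}} \<subseteq> eigenspace A 0"
      by (rule vec_lin_span_subset[OF _ eigenspace_submodule[OF A]]) (use w_eig in blast)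
    show "eigenspace A 0 \<subseteq> vec_lin_span n {w i |i. i \<in> {1..n - 1}}"
    proof
      fix x assume "x \<in> eigenspace A 0"
      then have x: "x \<in> carrier_vec n" and orth: "(\<Sum>j<n. u j * x $ j) = 0"
        using u[of 0] n by (auto simp: mem dest: spec[of _ 0])
      \<comment> \<open>\<open>?p k\<close> is the combination of the \<open>w i\<close> with i < k
        and coefficients - x_i. It agrees with x in the entries 1, ..., k - 1, and its entry 0 is
        the sum that these coefficients force. For k = n, orthogonality of x to u makes entry 0
        correct too.\<close>
      have partial: "Matrix.vec n (\<lambda>j. if j = 0 then - (\<Sum>i=1..<k. u i * x $ i) / u 0
            else if j < k then x $ j else 0) \<in> vec_lin_span n {w i |i. i \<in> {1..n - 1}}"
        (is "?p k \<in> ?V") if "1 \<le> k" "k \<le> n" for k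
        using that
      proof (induction k rule: dec_induct)
        case base
        have "?p 1 = 0\<^sub>v n"
          by (auto simp: Matrix.vec_eq_iff)
        then show ?case
          using vec_lin_span_closed(2)[OF w_carrier] by simp
      next
        case (step k)
        have "?p (Suc k) = ?p k + (- x $ k) \<cdot>\<^sub>v w k"
          using step.hyps step.prems w[of k] n by (auto simp: Matrix.vec_eq_iff diff_divide_distrib less_Suc_eq)
        moreover have "w k \<in> ?V"
          using vec_lin_span_closed(1)[OF w_carrier] step by (elim subsetD) auto
        ultimately show ?case
          using step vec_lin_span_closed(3,4)[OF w_carrier] by simp
      qed
      have "{..<n} = insert 0 {1..<n}"
        using n by auto
      then have "x $ 0 = - (\<Sum>i=1..<n. u i * x $ i) / u 0"
        using orth n u[of 0] by (simp add: field_simps)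
      then have "x = ?p n"
        using x by (auto simp: Matrix.vec_eq_iff)
      then show "x \<in> ?V"
        using partial[of n] n by simp
    qed
  qed
  show "eigenspace A (\<Sum>i<n. (u i)\<^sup>2) = vec_lin_span n {z}"
    unfolding m_def[symmetric]
  proof
    show "vec_lin_span n {z} \<subseteq> eigenspace A m"
      by (rule vec_lin_span_subset[OF _ eigenspace_submodule[OF A]]) (use z_eig in blast)
    show "eigenspace A m \<subseteq> vec_lin_span n {z}"
    proof
      fix x assume "x \<in> eigenspace A m"
      then have x: "x \<in> carrier_vec n" 
        and eig: "\<And>i. i < n \<Longrightarrow> u i * (\<Sum>j<n. u j * x $ j) = m * x $ i"
        by (auto simp: mem)
      define c where "c = (\<Sum>j<n. u j * x $ j)"
      have "x $ i = u i * c / m" if "i < n" for i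
        using eig[OF that] m by (simp add: c_def field_simps)
      then have "x = (c * u (n - 1) / m) \<cdot>\<^sub>v z"
        using x n u[of "n - 1"] by (auto simp: Matrix.vec_eq_iff z)
      then show "x \<in> vec_lin_span n {z}"
        using vec_lin_span_closed(1,4)[OF z_carrier] by (metis insert_subset)
    qed
  qed
  show "{l. eigenvalue A l} = {0, \<Sum>i<n. (u i)\<^sup>2}"
    unfolding m_def[symmetric]
  proof (intro equalityI subsetI)
    fix l assume "l \<in> {l. eigenvalue A l}"
    then obtain x where x: "x \<in> eigenspace A l" "x \<noteq> 0\<^sub>v n"
      using eigenvalue_iff_eigenspace[OF A] by auto
    have "l = m" if "l \<noteq> 0"
    proof -
      \<comment> \<open>For l \<noteq> 0 the eigenvector is determined by the scalar c. Pairing it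
        with u again gives c = m * c / l, and c cannot vanish because x does not.\<close>
      define c where "c = (\<Sum>j<n. u j * x $ j)"
      have xc: "x $ i = u i * c / l" if "i < n" for i
        using x(1) \<open>l \<noteq> 0\<close> that by (simp add: mem c_def[symmetric] field_simps)
      have "c \<noteq> 0"
        using x xc by (auto simp: mem Matrix.vec_eq_iff)
      moreover have "(\<Sum>j<n. u j * x $ j) = (\<Sum>j<n. (u j)\<^sup>2 * (c / l))"
        by (intro sum.cong) (auto simp: xc power2_eq_square)
      then have "c = m * (c / l)"
        by (simp only: sum_distrib_right[symmetric] m_def c_def[symmetric])
      ultimately show ?thesis
        using that by (simp add: field_simps)
    qed
    then show "l \<in> {0, m}"
      by auto
  next
    fix l assume "l \<in> {0, m}"
    moreover have "w 1 $ 1 \<noteq> 0" "z $ 0 \<noteq> 0"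
      using w[of 1] z n u[of 0] u[of "n - 1"] by auto
    then have "w 1 \<noteq> 0\<^sub>v n" "z \<noteq> 0\<^sub>v n"
      using n by auto
    ultimately show "l \<in> {l. eigenvalue A l}"
      using w_eig[of 1] z_eig n eigenvalue_iff_eigenspace[OF A] by auto
  qed
qed

section \<open>Gram--Schmidt orthogonalisation\<close>

notation inner (infix "\<bullet>" 70)
notation vec_nth (infixl "$" 90)
no_notation scalar_prod (infix "\<bullet>" 70)
no_notation vec_index (infixl "$" 100)

text \<open>
  If \<open>gs x i = 0\<close>, the quotient is \<open>0\<close> and the recursion skips \<open>gs x i\<close>; hence linearly dependent
  points need no separate treatment.
\<close>
fun gs :: "(nat \<Rightarrow> 'a::real_inner) \<Rightarrow> nat \<Rightarrow> 'a" where
  "gs x j = x j - (\<Sum>i\<in>{1..<j}. ((x j \<bullet> gs x i) / (gs x i \<bullet> gs x i)) *\<^sub>R gs x i)"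

declare gs.simps [simp del]

lemma gs_orthogonal: "1 \<le> i \<Longrightarrow> i < j \<Longrightarrow> gs x j \<bullet> gs x i = 0"
proof (induction j arbitrary: i rule: less_induct)
  case (less j)
  have orth: "gs x l \<bullet> gs x i = 0" if "l \<in> {1..<j} - {i}" for l
  proof (cases "l < i")
    case True
    then show ?thesis
      using less.IH[of i l] less.prems that by (simp add: inner_commute)
  qed (use less.IH[of l i] less.prems that in auto)
  have "(\<Sum>l\<in>{1..<j}. (x j \<bullet> gs x l) / (gs x l \<bullet> gs x l) * (gs x l \<bullet> gs x i)) =
      (\<Sum>l\<in>{i}. (x j \<bullet> gs x l) / (gs x l \<bullet> gs x l) * (gs x l \<bullet> gs x i))"
    using less.prems orth by (intro sum.mono_neutral_right) auto
  \<comment> \<open>Cancelling the remaining quotient is legitimate even if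
    \<open>gs x i = 0\<close>, since then both sides are 0.\<close>
  then have "(\<Sum>l\<in>{1..<j}. (x j \<bullet> gs x l) / (gs x l \<bullet> gs x l) * (gs x l \<bullet> gs x i)) = x j \<bullet> gs x i"
    by simp
  then show ?case
    by (subst gs.simps) (simp add: inner_diff_left inner_sum_left)
qed

text \<open>Changing a later point leaves the earlier Gram--Schmidt vectors alone; this lets the
  points be integrated out one at a time, the last one first.\<close>

lemma gs_cong: "(\<And>i. 1 \<le> i \<Longrightarrow> i \<le> j \<Longrightarrow> x i = y i) \<Longrightarrow> 1 \<le> j \<Longrightarrow> gs x j = gs y j"
proof (induction j rule: less_induct)
  case (less j)
  then show ?case
    by (subst (1 2) gs.simps) (auto intro!: arg_cong2[of _ _ _ _ minus] sum.cong)
qed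

lemma gs_in_span: "1 \<le> j \<Longrightarrow> gs x j \<in> span (x ` {1..j})"
proof (induction j rule: less_induct)
  case (less j)
  have "gs x i \<in> span (x ` {1..j})" if "i \<in> {1..<j}" for i
    using less.IH[of i] that by (auto intro: subsetD[OF span_mono, of "x ` {1..i}"])
  moreover have "x j \<in> span (x ` {1..j})"
    using less.prems by (intro span_base) auto
  ultimately show ?case
    by (subst gs.simps) (auto intro!: span_diff span_sum span_mul)
qed

lemma diff_gs_in_span: "x j - gs x j \<in> span (x ` {1..<j})"
proof -
  have "gs x i \<in> span (x ` {1..<j})" if "i \<in> {1..<j}" for i
    using gs_in_span[of i x] that by (auto intro: subsetD[OF span_mono, of "x ` {1..i}"])
  then show ?thesis
    by (subst gs.simps) (auto intro!: span_sum span_mul)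
qed

text \<open>\<open>gs x j\<close> differs from \<open>x j\<close> only by multiples of earlier
  Gram--Schmidt vectors, which c does not see. With c = \<open>gs x j\<close> this bounds the norm
  from above; with c a unit vector orthogonal to the earlier points it bounds the norm from
  below.\<close>

lemma inner_gs: "(\<And>i. 1 \<le> i \<Longrightarrow> i < j \<Longrightarrow> gs x i \<bullet> c = 0) \<Longrightarrow> gs x j \<bullet> c = x j \<bullet> c"
  by (subst gs.simps) (simp add: inner_diff_left inner_sum_left)

lemma norm_gs_le: "norm (gs x j) \<le> norm (x j)"
proof -
  have "x j \<bullet> gs x j = gs x j \<bullet> gs x j"
    by (rule inner_gs[symmetric]) (metis gs_orthogonal inner_commute)
  then have "norm (gs x j) * norm (gs x j) \<le> norm (x j) * norm (gs x j)"
    by (metis norm_cauchy_schwarz power2_eq_square power2_norm_eq_inner)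
  then show ?thesis
    by (cases "gs x j = 0") auto
qed

lemma gs_measurable:
  fixes k :: nat
  assumes "1 \<le> j" "j \<le> k"
  shows "(\<lambda>x. gs x j) \<in> borel_measurable (\<Pi>\<^sub>M l\<in>{1..k}. (lborel :: 'a::euclidean_space measure))"
  using assms
proof (induction j rule: less_induct)
  case (less j)
  have [measurable]: "(\<lambda>x. x j) \<in> borel_measurable (\<Pi>\<^sub>M l\<in>{1..k}. (lborel :: 'a measure))"
    using less.prems measurable_component_singleton[of j "{1..k}" "\<lambda>_. lborel :: 'a measure"] by simp
  have "(\<lambda>x. gs x i) \<in> borel_measurable (\<Pi>\<^sub>M l\<in>{1..k}. (lborel :: 'a measure))"
    if "i \<in> {1..<j}" for i
    using less.IH[of i] less.prems that by auto
  note this[measurable]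
  show ?case
    by (subst gs.simps) measurable
qed

text \<open>Gram--Schmidt without normalisation is a sequence of row operations of determinant 1,
  and a matrix with orthogonal rows has a diagonal Gram matrix. The sign depends on the numbering h,
  hence the absolute value.\<close>

lemma abs_det_gs:
  fixes x :: "nat \<Rightarrow> real ^ 'd" and h :: "'d \<Rightarrow> nat"
  assumes h: "bij_betw h UNIV {1..CARD('d)}"
  shows "\<bar>Determinants.det (\<chi> i. x (h i))\<bar> = (\<Prod>j=1..CARD('d). norm (gs x j))"
proof -
  have h_range: "h i \<in> {1..CARD('d)}" for i
    using h by (auto simp: bij_betw_def)
  have h_eq: "h i = h j \<longleftrightarrow> i = j" for i j
    using h by (auto simp: bij_betw_def inj_on_def)
  \<comment> \<open>\<open>M\<close> interpolates between the orthogonalised rows (m = 0) and the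
    original ones (m = d). The passage from m - 1 to m alters only row number m, at a stage where
    all rows of smaller number are already the original points, so the added difference lies in the
    span of other rows.\<close>
  define M :: "nat \<Rightarrow> real^'d^'d" where "M m = (\<chi> i. if h i \<le> m then x (h i) else gs x (h i))" for m
  have step: "Determinants.det (M m) = Determinants.det (M (m - 1))" if m: "m \<in> {1..CARD('d)}" for m
  proof -
    obtain l where l: "h l = m"
      using h m by (metis bij_betw_iff_bijections)
    have "x ` {1..<m} \<subseteq> {Finite_Cartesian_Product.row j (M (m - 1)) |j. j \<noteq> l}"
    proof
      fix y assume "y \<in> x ` {1..<m}"
      then obtain i where i: "i \<in> {1..<m}" "y = x i"
        by auto
      obtain j where "h j = i"
        using h m i by (metis bij_betw_iff_bijections atLeastAtMost_iff atLeastLessThan_iff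
            less_imp_le order_trans)
      then show "y \<in> {Finite_Cartesian_Product.row j (M (m - 1)) |j. j \<noteq> l}"
        using i l by (auto simp: Finite_Cartesian_Product.row_def M_def Finite_Cartesian_Product.vec_eq_iff intro!: exI[of _ j])
    qed
    then have "x m - gs x m \<in> vec.span {Finite_Cartesian_Product.row j (M (m - 1)) |j. j \<noteq> l}"
      using diff_gs_in_span[of x m] span_mono unfolding span_vec_eq by blast
    then have "Determinants.det (\<chi> k. if k = l then Finite_Cartesian_Product.row l (M (m - 1)) + (x m - gs x m) else Finite_Cartesian_Product.row k (M (m - 1))) =
        Determinants.det (M (m - 1))"
      by (rule det_row_span)
    moreover have "(\<chi> k. if k = l then Finite_Cartesian_Product.row l (M (m - 1)) + (x m - gs x m) else Finite_Cartesian_Product.row k (M (m - 1))) = M m"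
    proof -
      have row: "Finite_Cartesian_Product.row k (M (m - 1)) = M (m - 1) $ k" for k
        by (simp add: Finite_Cartesian_Product.row_def)
      have "h k \<le> m - 1 \<longleftrightarrow> h k \<le> m \<and> k \<noteq> l" for k
        using h_eq[of k l] l m by auto
      then show ?thesis
        using l m unfolding row by (auto simp: M_def Finite_Cartesian_Product.vec_eq_iff)
    qed
    ultimately show ?thesis
      by simp
  qed
  have "Determinants.det (M m) = Determinants.det (M 0)" if "m \<le> CARD('d)" for m
    using that
  proof (induction m)
    case (Suc m)
    then show ?case
      using step[of "Suc m"] by simp
  qed simp
  moreover have "M CARD('d) = (\<chi> i. x (h i))"
    using h_range by (auto simp: M_def)
  ultimately have "Determinants.det (\<chi> i. x (h i)) = Determinants.det (M 0)"
    by (metis order_refl)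
  \<comment> \<open>Squaring replaces the determinant by that of the Gram matrix, whose off-diagonal
    entries vanish.\<close>
  moreover have "(Determinants.det (M 0))\<^sup>2 = (\<Prod>j=1..CARD('d). norm (gs x j))\<^sup>2"
  proof -
    have M0: "M 0 $ i = gs x (h i)" for i
      using h_range[of i] by (auto simp: M_def)
    have orth: "gs x (h i) \<bullet> gs x (h j) = 0" if "i \<noteq> j" for i j
    proof -
      have "h i < h j \<or> h j < h i"
        using h_eq[of i j] that by arith
      then show ?thesis
        using gs_orthogonal[of "h i" "h j" x] gs_orthogonal[of "h j" "h i" x] h_range[of i] h_range[of j]
        by (auto simp: inner_commute)
    qed
    have entries: "(M 0 ** transpose (M 0)) $ i $ j = gs x (h i) \<bullet> gs x (h j)" for i j
      by (simp add: matrix_matrix_mult_def transpose_def inner_vec_def M0)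
    have "Determinants.det (M 0) * Determinants.det (M 0) = Determinants.det (M 0 ** transpose (M 0))"
      by (simp add: det_mul)
    also have "\<dots> = (\<Prod>i\<in>UNIV. gs x (h i) \<bullet> gs x (h i))"
      by (subst det_diagonal) (auto simp: entries orth)
    also have "\<dots> = (\<Prod>j=1..CARD('d). gs x j \<bullet> gs x j)"
      by (rule prod.reindex_bij_betw[OF h])
    also have "\<dots> = (\<Prod>j=1..CARD('d). norm (gs x j))\<^sup>2"
      by (simp add: prod_power_distrib power2_norm_eq_inner)
    finally show ?thesis
      by (simp add: power2_eq_square)
  qed
  ultimately show ?thesis
    by (metis abs_of_nonneg norm_ge_zero power2_abs power2_eq_imp_eq abs_ge_zero prod_nonneg)
qed

section \<open>Images of product sets under linear combinations\<close>

declare One_nat_def [simp del] upt_Suc [simp del]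

section \<open>Relabelling of coordinates in product measures\<close>

lemma PiM_reindex:
  fixes M :: "'b measure"
  assumes t: "bij_betw t J K" and K: "finite K" and M: "sigma_finite_measure M"
  shows "distr (\<Pi>\<^sub>M i\<in>K. M) (\<Pi>\<^sub>M i\<in>J. M) (\<lambda>\<omega>. \<lambda>j\<in>J. \<omega> (t j)) = (\<Pi>\<^sub>M i\<in>J. M)"
proof -
  interpret product_sigma_finite "\<lambda>_. M"
    using M by (simp add: product_sigma_finite_def)
  have J: "finite J"
    using bij_betw_finite[OF t] K by simp
  have t_mem: "t j \<in> K" if "j \<in> J" for j
    using t that by (auto simp: bij_betw_def)
  define s where "s = the_inv_into J t"
  have s: "s (t j) = j" if "j \<in> J" for j
    using t that by (simp add: s_def bij_betw_def the_inv_into_f_f)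
  have s': "s i \<in> J" "t (s i) = i" if "i \<in> K" for i
    using t that s by (force simp: bij_betw_def)+
  have meas: "(\<lambda>\<omega>. \<lambda>j\<in>J. \<omega> (t j)) \<in> measurable (\<Pi>\<^sub>M i\<in>K. M) (\<Pi>\<^sub>M i\<in>J. M)"
    using t_mem by (intro measurable_restrict measurable_component_singleton) auto
  show ?thesis
  proof (rule PiM_eqI[OF J])
    fix A assume A: "\<And>i. i \<in> J \<Longrightarrow> A i \<in> sets M"
    have "(\<lambda>\<omega>. \<lambda>j\<in>J. \<omega> (t j)) -` Pi\<^sub>E J A \<inter> space (\<Pi>\<^sub>M i\<in>K. M) = (\<Pi>\<^sub>E i\<in>K. A (s i))"
    proof (intro equalityI subsetI)
      fix \<omega> assume \<omega>: "\<omega> \<in> (\<lambda>\<omega>. \<lambda>j\<in>J. \<omega> (t j)) -` Pi\<^sub>E J A \<inter> space (\<Pi>\<^sub>M i\<in>K. M)"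
      have "\<omega> i \<in> A (s i)" if "i \<in> K" for i
        using \<omega> s'[OF that] by (auto simp: PiE_iff dest!: bspec[of J _ "s i"])
      then show "\<omega> \<in> (\<Pi>\<^sub>E i\<in>K. A (s i))"
        using \<omega> by (auto simp: space_PiM PiE_iff)
    next
      fix \<omega> assume \<omega>: "\<omega> \<in> (\<Pi>\<^sub>E i\<in>K. A (s i))"
      then have "\<omega> (t j) \<in> A j" if "j \<in> J" for j
        using t_mem[OF that] s[OF that] by (metis PiE_mem)
      moreover have "\<omega> i \<in> space M" if "i \<in> K" for i
        using \<omega> A[THEN sets.sets_into_space] s'(1) that by (meson PiE_mem subsetD)
      ultimately show "\<omega> \<in> (\<lambda>\<omega>. \<lambda>j\<in>J. \<omega> (t j)) -` Pi\<^sub>E J A \<inter> space (\<Pi>\<^sub>M i\<in>K. M)"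
        using \<omega> by (auto simp: space_PiM PiE_iff)
    qed
    moreover have "Pi\<^sub>E J A \<in> sets (\<Pi>\<^sub>M i\<in>J. M)"
      using A J by (intro sets_PiM_I_finite) auto
    ultimately have "emeasure (distr (\<Pi>\<^sub>M i\<in>K. M) (\<Pi>\<^sub>M i\<in>J. M) (\<lambda>\<omega>. \<lambda>j\<in>J. \<omega> (t j))) (Pi\<^sub>E J A) =
        emeasure (\<Pi>\<^sub>M i\<in>K. M) (\<Pi>\<^sub>E i\<in>K. A (s i))"
      by (simp add: emeasure_distr[OF meas])
    also have "\<dots> = (\<Prod>i\<in>K. emeasure M (A (s i)))"
      using A s' K by (intro emeasure_PiM) auto
    also have "\<dots> = (\<Prod>j\<in>J. emeasure M (A j))"
      using s by (subst prod.reindex_bij_betw[OF t, symmetric]) auto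
    finally show "emeasure (distr (\<Pi>\<^sub>M i\<in>K. M) (\<Pi>\<^sub>M i\<in>J. M) (\<lambda>\<omega>. \<lambda>j\<in>J. \<omega> (t j))) (Pi\<^sub>E J A) =
        (\<Prod>j\<in>J. emeasure M (A j))" .
  qed simp
qed

text \<open>Both measures agree on boxes. With numbers as indices, vectors over different index
  types of equal cardinality are compared through one and the same product space.\<close>

lemma lborel_vec_eq_distr_PiM:
  fixes h :: "'n::finite \<Rightarrow> nat"
  assumes h: "bij_betw h UNIV I"
  shows "(lborel :: (real^'n) measure) = distr (\<Pi>\<^sub>M i\<in>I. lborel) borel (\<lambda>c. \<chi> i. c (h i))"
proof (rule lborel_eqI)
  interpret product_sigma_finite "\<lambda>_. lborel :: real measure"
    by (simp add: product_sigma_finite_def lborel.sigma_finite_measure_axioms)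
  have I: "finite I" and h_mem: "\<And>i. h i \<in> I"
    using h bij_betw_finite[OF h] by (auto simp: bij_betw_def)
  define s where "s = the_inv_into UNIV h"
  have s: "s (h i) = i" for i
    using h by (simp add: s_def bij_betw_def the_inv_into_f_f)
  have s': "h (s j) = j" if "j \<in> I" for j
    using f_the_inv_into_f_bij_betw[OF h that] by (simp add: s_def)
  have meas: "(\<lambda>c. \<chi> i. c (h i)) \<in> (\<Pi>\<^sub>M i\<in>I. lborel) \<rightarrow>\<^sub>M (borel :: (real^'n) measure)"
    using h_mem by (subst borel_measurable_euclidean_space) (auto simp: Basis_vec_def inner_axis)
  fix l u :: "real^'n"
  assume lu: "\<And>b. b \<in> Basis \<Longrightarrow> l \<bullet> b \<le> u \<bullet> b"
  then have lu': "l $ i \<le> u $ i" for i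
    using lu[of "axis i 1"] by (auto simp: Basis_vec_def inner_axis)
  have "(\<lambda>c. \<chi> i. c (h i)) -` box l u \<inter> space (\<Pi>\<^sub>M i\<in>I. lborel) = (\<Pi>\<^sub>E j\<in>I. {l $ s j<..<u $ s j})"
    (is "?L = ?R")
  proof (intro equalityI subsetI)
    fix c assume c: "c \<in> ?L"
    then have "c (h (s j)) \<in> {l $ s j<..<u $ s j}" for j
      by (auto simp: mem_box_cart)
    then have "c j \<in> {l $ s j<..<u $ s j}" if "j \<in> I" for j
      by (metis s' that)
    then show "c \<in> ?R"
      using c by (auto simp: space_PiM PiE_iff s')
  next
    fix c assume c: "c \<in> ?R"
    then have "c (h i) \<in> {l $ s (h i)<..<u $ s (h i)}" for i
      using h_mem by (metis PiE_mem)
    then show "c \<in> ?L"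
      using c by (auto simp: space_PiM mem_box_cart s PiE_iff)
  qed
  then have "emeasure (distr (\<Pi>\<^sub>M i\<in>I. lborel) borel (\<lambda>c. \<chi> i. c (h i))) (box l u) =
      (\<Prod>j\<in>I. emeasure lborel {l $ s j<..<u $ s j})"
    using I by (simp add: emeasure_distr[OF meas] emeasure_PiM)
  also have "\<dots> = (\<Prod>i\<in>UNIV. ennreal (u $ i - l $ i))"
    using lu' s by (subst prod.reindex_bij_betw[OF h, symmetric]) auto
  also have "\<dots> = (\<Prod>b\<in>Basis. ennreal ((u - l) \<bullet> b))"
  proof -
    have basis: "(Basis :: (real^'n) set) = range (\<lambda>i. axis i 1)"
      by (auto simp: Basis_vec_def)
    have "inj (\<lambda>i::'n. axis i (1::real))"
      by (auto simp: inj_def axis_eq_axis)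
    then show ?thesis
      unfolding basis by (subst prod.reindex) (simp_all add: inner_axis)
  qed
  finally show "emeasure (distr (\<Pi>\<^sub>M i\<in>I. lborel) borel (\<lambda>c. \<chi> i. c (h i))) (box l u) =
      (\<Prod>b\<in>Basis. (u - l) \<bullet> b)"
    using lu by (simp add: prod_ennreal inner_diff_left)
qed simp

text \<open>
  The change of variables formula for linear maps is available only for vectors with a well-ordered
  index type.  The type below supplies such an index type of the same cardinality as \<open>'n\<close>.
\<close>
typedef (overloaded) 'n idx = "{1..CARD('n::finite)}"
  by (auto intro!: exI[of _ 1] simp: Suc_le_eq One_nat_def)

setup_lifting type_definition_idx

instantiation idx :: (finite) "{finite, wellorder}"
begin

lift_definition less_eq_idx :: "'a idx \<Rightarrow> 'a idx \<Rightarrow> bool" is "(\<le>)" .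

lift_definition less_idx :: "'a idx \<Rightarrow> 'a idx \<Rightarrow> bool" is "(<)" .

instance
proof
  have "finite (Abs_idx ` {1..CARD('a)} :: 'a idx set)"
    by simp
  then show "finite (UNIV :: 'a idx set)"
    by (simp add: type_definition.univ[OF type_definition_idx])
  show "P x" if "\<And>x. (\<And>y. y < x \<Longrightarrow> P y) \<Longrightarrow> P x" for P and x :: "'a idx"
  proof (induction x rule: measure_induct_rule[of Rep_idx])
    case (less x)
    then show ?case
      using that by (simp add: less_idx.rep_eq)
  qed
qed (transfer; auto)+

end

lemma Rep_idx_bij: "bij_betw Rep_idx (UNIV :: 'n::finite idx set) {1..CARD('n)}"
  by (metis (no_types) type_definition.Rep_range[OF type_definition_idx] bij_betw_def inj_onI
      Rep_idx_inject)


lemma gs_linear_isometry: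
  fixes f :: "'a::real_inner \<Rightarrow> 'b::real_inner"
  assumes f: "linear f" "\<And>v w. f v \<bullet> f w = v \<bullet> w"
  shows "gs (\<lambda>j. f (x j)) j = f (gs x j)"
proof (induction j rule: less_induct)
  case (less j)
  then show ?case
    \<comment> \<open>The recursion uses only inner products and linear combinations, and f respects
      both.\<close>
    by (subst (1 2) gs.simps) (simp add: f linear_diff linear_sum linear_scale)
qed

text \<open>This is the change of variables formula for the linear map with the points as columns,
  with the determinant rewritten by \<open>abs_det_gs\<close>. The map may be singular and need not
  send Borel sets to Borel sets, so measurability of the image is assumed; it converts the Lebesgue
  measure of the image into \<open>lborel\<close>.\<close>

lemma measure_linear_combinations_wellorder:
  fixes x :: "nat \<Rightarrow> real ^ 'n::{finite,wellorder}" and h :: "'n \<Rightarrow> nat"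
  assumes h: "bij_betw h UNIV {1..CARD('n)}"
    and Q: "Q \<in> sets (\<Pi>\<^sub>M j\<in>{1..CARD('n)}. lborel)"
    and fin: "emeasure (\<Pi>\<^sub>M j\<in>{1..CARD('n)}. lborel) Q < \<infinity>"
    and im: "(\<lambda>c. \<Sum>j=1..CARD('n). c j *\<^sub>R x j) ` Q \<in> sets borel"
  shows "measure lborel ((\<lambda>c. \<Sum>j=1..CARD('n). c j *\<^sub>R x j) ` Q) =
    (\<Prod>j=1..CARD('n). norm (gs x j)) * measure (\<Pi>\<^sub>M j\<in>{1..CARD('n)}. lborel) Q"
proof -
  let ?I = "{1..CARD('n)}" and ?P = "\<Pi>\<^sub>M j\<in>{1..CARD('n)}. (lborel :: real measure)"
  define s where "s = the_inv_into UNIV h"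
  have s: "s (h i) = i" for i
    using h by (simp add: s_def bij_betw_def the_inv_into_f_f)
  have s': "h (s j) = j" if "j \<in> ?I" for j
    using f_the_inv_into_f_bij_betw[OF h that] by (simp add: s_def)
  have h_mem: "h i \<in> ?I" for i
    using h by (auto simp: bij_betw_def)
  define coords :: "real^'n::_ \<Rightarrow> nat \<Rightarrow> real" where "coords v = (\<lambda>j\<in>?I. v $ s j)" for v
  have coords_meas: "coords \<in> borel \<rightarrow>\<^sub>M ?P"
    unfolding coords_def by (intro measurable_restrict) simp
  have coords_inv: "coords (\<chi> i. c (h i)) = c" if "c \<in> space ?P" for c
    using that s' by (auto simp: coords_def space_PiM PiE_iff extensional_def fun_eq_iff)
  have Q_space: "Q \<subseteq> space ?P"
    using Q by (rule sets.sets_into_space)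
  define V where "V = coords -` Q"
  have V: "V \<in> sets borel"
    using measurable_sets[OF coords_meas Q] by (simp add: V_def)
  have meas: "(\<lambda>c. \<chi> i. c (h i)) \<in> ?P \<rightarrow>\<^sub>M (borel :: (real^'n::_) measure)"
    using h_mem by (subst borel_measurable_euclidean_space) (auto simp: Basis_vec_def inner_axis)
  have "(\<lambda>c. \<chi> i. c (h i)) -` V \<inter> space ?P = Q"
    using Q_space coords_inv by (auto simp: V_def)
  then have V_measure: "emeasure lborel V = emeasure ?P Q"
    using V by (simp add: lborel_vec_eq_distr_PiM[OF h] emeasure_distr[OF meas])
  have V_lmeas: "V \<in> lmeasurable"
    using V V_measure fin by (auto simp: fmeasurable_def)
  define f :: "real^'n::_ \<Rightarrow> real^'n::_" where "f v = (\<Sum>i\<in>UNIV. v $ i *\<^sub>R x (h i))" for v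
  have "linear f"
    unfolding f_def by (intro linearI) (simp_all add: algebra_simps sum.distrib scaleR_sum_right)
  have f_eq: "f v = (\<Sum>j=1..CARD('n). coords v j *\<^sub>R x j)" for v
    unfolding f_def by (subst sum.reindex_bij_betw[OF h, symmetric]) (use h_mem s in \<open>auto simp: coords_def\<close>)
  have "coords ` V = Q"
  proof (intro equalityI subsetI)
    fix c assume "c \<in> Q"
    then have "c = coords (\<chi> i. c (h i))"
      using Q_space coords_inv by auto
    with \<open>c \<in> Q\<close> show "c \<in> coords ` V"
      unfolding V_def by (metis image_eqI vimageI2)
  qed (auto simp: V_def)
  then have f_image: "f ` V = (\<lambda>c. \<Sum>j=1..CARD('n). c j *\<^sub>R x j) ` Q"
    by (auto simp: f_eq image_image)
  \<comment> \<open>The points are the columns of the matrix of f, but the rows in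
    \<open>abs_det_gs\<close>.\<close>
  have "matrix f = Finite_Cartesian_Product.transpose (\<chi> i. x (h i))"
    by (auto simp: matrix_def f_def Finite_Cartesian_Product.transpose_def
        Finite_Cartesian_Product.vec_eq_iff axis_def if_distrib[of "\<lambda>c. c * _"] cong: if_cong)
  then have "\<bar>Determinants.det (matrix f)\<bar> = (\<Prod>j=1..CARD('n). norm (gs x j))"
    using abs_det_gs[OF h, of x] by simp
  then have "measure lebesgue (f ` V) = (\<Prod>j=1..CARD('n). norm (gs x j)) * measure lebesgue V"
    using measure_linear_image[OF \<open>linear f\<close> V_lmeas] by simp
  moreover have "measure lebesgue V = measure ?P Q"
    using V V_measure by (simp add: measure_def)
  ultimately show ?thesis
    using im by (simp add: f_image)
qed

text \<open>Renaming coordinates by \<phi> is a linear isometry onto vectors over the well-ordered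
  type \<open>'n idx\<close>. It preserves Gram--Schmidt norms and Lebesgue measure, so the formula
  transfers back.\<close>

lemma measure_linear_combinations:
  fixes x :: "nat \<Rightarrow> real ^ 'n"
  assumes Q: "Q \<in> sets (\<Pi>\<^sub>M j\<in>{1..CARD('n)}. lborel)"
    and fin: "emeasure (\<Pi>\<^sub>M j\<in>{1..CARD('n)}. lborel) Q < \<infinity>"
    and im: "(\<lambda>c. \<Sum>j=1..CARD('n). c j *\<^sub>R x j) ` Q \<in> sets borel"
  shows "measure lborel ((\<lambda>c. \<Sum>j=1..CARD('n). c j *\<^sub>R x j) ` Q) =
    (\<Prod>j=1..CARD('n). norm (gs x j)) * measure (\<Pi>\<^sub>M j\<in>{1..CARD('n)}. lborel) Q"
proof -
  let ?I = "{1..CARD('n)}" and ?P = "\<Pi>\<^sub>M j\<in>{1..CARD('n)}. (lborel :: real measure)"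
  define A where "A = (\<lambda>c. \<Sum>j=1..CARD('n). c j *\<^sub>R x j) ` Q"
  obtain g :: "'n \<Rightarrow> nat" where g: "bij_betw g UNIV ?I"
    using finite_same_card_bij[of "UNIV :: 'n set" ?I] by auto
  define s where "s = the_inv_into UNIV g"
  have s: "s (g i) = i" for i
    using g by (simp add: s_def bij_betw_def the_inv_into_f_f)
  have s': "g (s j) = j" if "j \<in> ?I" for j
    using f_the_inv_into_f_bij_betw[OF g that] by (simp add: s_def)
  have g_mem: "g i \<in> ?I" for i
    using g by (auto simp: bij_betw_def)
  define e :: "'n idx \<Rightarrow> 'n" where "e i = s (Rep_idx i)" for i
  have "bij_betw s ?I UNIV"
    unfolding s_def by (rule bij_betw_the_inv_into[OF g])
  then have e: "bij e"
    unfolding e_def[abs_def] using Rep_idx_bij bij_betw_trans[of Rep_idx UNIV ?I s UNIV]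
    by (auto simp: comp_def)
  have Rep_mem: "Rep_idx i \<in> {1..CARD('n)}" for i :: "'n idx"
    by (rule Rep_idx)
  have g_e: "g (e i) = Rep_idx i" for i
    using s'[of "Rep_idx i"] Rep_idx[of i] by (simp add: e_def)
  define \<phi> :: "real^'n \<Rightarrow> real^'n idx" where "\<phi> v = (\<chi> i. v $ e i)" for v
  define \<psi> :: "real^'n idx \<Rightarrow> real^'n" where "\<psi> w = (\<chi> i. w $ inv_into UNIV e i)" for w
  have inv: "\<psi> (\<phi> v) = v" "\<phi> (\<psi> w) = w" for v w
    using e by (auto simp: \<phi>_def \<psi>_def bij_is_surj bij_is_inj surj_f_inv_f)
  have \<phi>_linear: "linear \<phi>" and \<phi>_inner: "\<phi> v \<bullet> \<phi> w = v \<bullet> w" for v w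
    using sum.reindex_bij_betw[OF e, of "\<lambda>i. v $ i * w $ i"]
    by (auto intro!: linearI simp: \<phi>_def inner_vec_def Finite_Cartesian_Product.vec_eq_iff)
  have \<psi>_meas: "\<psi> \<in> borel_measurable borel"
    unfolding \<psi>_def
    by (subst borel_measurable_euclidean_space) (auto simp: Basis_vec_def inner_axis)
  \<comment> \<open>Writing the image as a preimage under the measurable inverse shows that it is
    Borel.\<close>
  have "\<phi> ` A = \<psi> -` A"
    using inv by (auto simp: image_iff) metis
  then have \<phi>A: "\<phi> ` A \<in> sets borel"
    using measurable_sets[OF \<psi>_meas] im by (simp add: A_def)
  have \<phi>_sum: "\<phi> (\<Sum>j=1..CARD('n). c j *\<^sub>R x j) = (\<Sum>j=1..CARD('n). c j *\<^sub>R \<phi> (x j))" for c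
    using \<phi>_linear by (simp add: linear_sum linear_scale)
  have card: "CARD('n idx) = CARD('n)"
    using bij_betw_same_card[OF e] .
  have \<phi>A_eq: "\<phi> ` A = (\<lambda>c. \<Sum>j=1..CARD('n idx). c j *\<^sub>R \<phi> (x j)) ` Q"
    by (simp add: A_def image_image \<phi>_sum card)
  have Rep: "bij_betw Rep_idx (UNIV :: 'n idx set) {1..CARD('n idx)}"
    using Rep_idx_bij[where 'n = 'n] card by simp
  have "measure lborel (\<phi> ` A) = (\<Prod>j=1..CARD('n). norm (gs x j)) * measure ?P Q"
    using measure_linear_combinations_wellorder[OF Rep, of Q "\<lambda>j. \<phi> (x j)"] Q fin \<phi>A
      gs_linear_isometry[OF \<phi>_linear \<phi>_inner, of x]
    by (simp add: card \<phi>A_eq[unfolded card] norm_eq_sqrt_inner \<phi>_inner)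
  moreover have "emeasure lborel (\<phi> ` A) = emeasure lborel A"
  proof -
    have meas1: "(\<lambda>c. \<chi> i. c (g i)) \<in> ?P \<rightarrow>\<^sub>M (borel :: (real^'n) measure)"
      using g_mem by (subst borel_measurable_euclidean_space) (auto simp: Basis_vec_def inner_axis)
    have meas2: "(\<lambda>c. \<chi> i. c (Rep_idx i)) \<in> ?P \<rightarrow>\<^sub>M (borel :: (real^'n idx) measure)"
      using Rep_mem by (subst borel_measurable_euclidean_space) (auto simp: Basis_vec_def inner_axis)
    \<comment> \<open>As pushforwards of the same product measure, the two Lebesgue measures only
      require equal preimages, and e was chosen to make the two numberings of coordinates
      match.\<close>
    have "(\<chi> i. c (Rep_idx i)) = \<phi> (\<chi> i. c (g i))" for c :: "nat \<Rightarrow> real"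
      by (simp add: \<phi>_def g_e)
    then have "(\<lambda>c. \<chi> i. c (Rep_idx i)) -` (\<phi> ` A) \<inter> space ?P = (\<lambda>c. \<chi> i. c (g i)) -` A \<inter> space ?P"
      using inv by (auto simp: image_iff) metis
    then show ?thesis
      using \<phi>A im
      by (simp add: lborel_vec_eq_distr_PiM[OF g] lborel_vec_eq_distr_PiM[OF Rep_idx_bij]
          emeasure_distr[OF meas1] emeasure_distr[OF meas2] A_def)
  qed
  ultimately show ?thesis
    by (simp add: A_def measure_def)
qed

section \<open>The volume of a simplex\<close>

lemma gs_eq_self:
  assumes "\<And>i. 1 \<le> i \<Longrightarrow> i < j \<Longrightarrow> x j \<bullet> x i = 0"
  shows "gs x j = x j"
proof -
  have "x j \<bullet> gs x i = 0" if i: "i \<in> {1..<j}" for i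
  proof -
    have "Linear_Algebra.orthogonal (x j) (gs x i)"
    proof (rule orthogonal_to_span)
      show "gs x i \<in> span (x ` {1..i})"
        using i by (intro gs_in_span) simp
      show "Linear_Algebra.orthogonal (x j) y" if "y \<in> x ` {1..i}" for y
        using that i assms unfolding Linear_Algebra.orthogonal_def by auto
    qed
    then show ?thesis
      by (simp add: Linear_Algebra.orthogonal_def)
  qed
  then have "(\<Sum>i\<in>{1..<j}. ((x j \<bullet> gs x i) / (gs x i \<bullet> gs x i)) *\<^sub>R gs x i) = 0"
    by (intro sum.neutral) simp
  then show ?thesis
    unfolding gs.simps[of x j] by simp
qed

text \<open>A numbered orthonormal basis, constrained only on the indices 1, ..., d. The numbering
  lets an initial segment span a given subspace while the remaining vectors span its orthogonal
  complement.\<close>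

definition orthonormal_frame :: "(nat \<Rightarrow> 'a::euclidean_space) \<Rightarrow> bool" where
  "orthonormal_frame e \<longleftrightarrow>
     (\<forall>i\<in>{1..DIM('a)}. \<forall>j\<in>{1..DIM('a)}. e i \<bullet> e j = (if i = j then 1 else 0))"

text \<open>An orthonormal basis C of the orthogonal complement of span B is appended to B. The
  dimension formula for complements makes the total number of vectors equal to the
  dimension.\<close>

lemma orthonormal_set_extend:
  fixes B :: "'a::euclidean_space set"
  assumes B: "orthonormal_set B"
  obtains e where "orthonormal_frame e" "bij_betw e {1..card B} B" "card B \<le> DIM('a)"
proof -
  have ind: "independent B"
    using B by (intro pairwise_orthogonal_independent) (auto simp: orthonormal_set_def)
  have fin: "finite B"
    using B by (simp add: orthonormal_set_def)
  define W where "W = {y \<in> UNIV. \<forall>x\<in>span B. Linear_Algebra.orthogonal x y}"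
  have "dim W + dim (span B) = dim (UNIV :: 'a set)"
    unfolding W_def by (rule dim_subspace_orthogonal_to_vectors) auto
  then have dim_W: "dim W + card B = DIM('a)"
    using ind by (simp add: dim_eq_card_independent)
  have "Real_Vector_Spaces.subspace W"
    unfolding W_def
    by (auto simp: real_vector.subspace_def Linear_Algebra.orthogonal_def inner_add_right)
  then obtain C where C: "C \<subseteq> W" "pairwise Linear_Algebra.orthogonal C"
      "\<And>x. x \<in> C \<Longrightarrow> norm x = 1" "independent C" "card C = dim W"
    by (metis orthonormal_basis_subspace)
  have "finite C"
    using C(4) by (rule independent_imp_finite)
  have BC: "b \<bullet> c = 0" if "b \<in> B" "c \<in> C" for b c
    using that C(1) by (auto simp: W_def Linear_Algebra.orthogonal_def span_base)
  have disjoint: "b \<noteq> c" if "b \<in> B" "c \<in> C" for b c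
    using BC[OF that] C(3)[OF that(2)] by auto
  obtain f where f: "bij_betw f {1..card B} B"
    using finite_same_card_bij[of "{1..card B}" B] fin by auto
  obtain g where g: "bij_betw g {card B + 1..DIM('a)} C"
  proof -
    have "card {card B + 1..DIM('a)} = card C"
      using C(5) dim_W by simp
    then show ?thesis
      using finite_same_card_bij[of "{card B + 1..DIM('a)}" C] \<open>finite C\<close> that by blast
  qed
  define e where "e i = (if i \<le> card B then f i else g i)" for i
  have e_B: "e i \<in> B" if "i \<in> {1..card B}" for i
    using that f by (auto simp: e_def bij_betw_def)
  have e_C: "e i \<in> C" if "i \<in> {card B + 1..DIM('a)}" for i
    using that g by (auto simp: e_def bij_betw_def)
  have e_inj: "e i \<noteq> e j" if "i \<in> {1..DIM('a)}" "j \<in> {1..DIM('a)}" "i \<noteq> j" for i j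
  proof -
    have mem: "l \<in> {1..card B} \<or> l \<in> {card B + 1..DIM('a)}" if "l \<in> {1..DIM('a)}" for l
      using that by auto
    have "e i \<noteq> e j" if "i \<in> {1..card B}" "j \<in> {1..card B}"
      using inj_onD[OF bij_betw_imp_inj_on[OF f] _ that] \<open>i \<noteq> j\<close> that by (auto simp: e_def)
    moreover have "e i \<noteq> e j" if "i \<in> {card B + 1..DIM('a)}" "j \<in> {card B + 1..DIM('a)}"
      using inj_onD[OF bij_betw_imp_inj_on[OF g] _ that] \<open>i \<noteq> j\<close> that by (auto simp: e_def)
    ultimately show ?thesis
      using mem[OF that(1)] mem[OF that(2)] e_B e_C disjoint by metis
  qed
  have mem: "e l \<in> B \<or> e l \<in> C" if "l \<in> {1..DIM('a)}" for l
    using that e_B[of l] e_C[of l] by (cases "l \<le> card B") auto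
  have "e i \<bullet> e j = (if i = j then 1 else 0)" if ij: "i \<in> {1..DIM('a)}" "j \<in> {1..DIM('a)}" for i j
  proof (cases "i = j")
    case True
    have "e i \<in> B \<or> e i \<in> C"
      using ij mem by blast
    then have "norm (e i) = 1"
      using B C(3) by (auto simp: orthonormal_set_def)
    then show ?thesis
      using True by (simp add: norm_eq_sqrt_inner)
  next
    case False
    have "e i \<in> B \<or> e i \<in> C" "e j \<in> B \<or> e j \<in> C"
      using ij mem by blast+
    then show ?thesis
      using False e_inj[OF ij False] B C(2) BC[of "e i" "e j"] BC[of "e j" "e i"]
      by (auto simp: orthonormal_set_def pairwise_def Linear_Algebra.orthogonal_def inner_commute)
  qed
  then have "orthonormal_frame e"
    by (simp add: orthonormal_frame_def)
  moreover have "bij_betw e {1..card B} B"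
    using f by (subst bij_betw_cong[of _ _ f]) (auto simp: e_def)
  ultimately show ?thesis
    using that[of e] dim_W by simp
qed

lemma subspace_orthonormal_frame:
  fixes V :: "'a::euclidean_space set"
  assumes "Real_Vector_Spaces.subspace V"
  obtains e where "orthonormal_frame e" "V = span (e ` {1..dim V})"
proof -
  obtain B where B: "pairwise Linear_Algebra.orthogonal B" "\<And>x. x \<in> B \<Longrightarrow> norm x = 1"
    "independent B" "card B = dim V" "span B = V"
    using orthonormal_basis_subspace[OF assms] by metis
  then have "orthonormal_set B"
    by (simp add: orthonormal_set_def independent_imp_finite)
  then obtain e where e: "orthonormal_frame e" "bij_betw e {1..card B} B"
    by (metis orthonormal_set_extend)
  then show ?thesis
    using that[of e] B by (simp add: bij_betw_def)
qed

section \<open>Coordinates with respect to an orthonormal frame\<close>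

lemma orthonormal_frame_inner_sum:
  fixes e :: "nat \<Rightarrow> 'a::euclidean_space"
  assumes "orthonormal_frame e" "i \<in> {1..DIM('a)}" "J \<subseteq> {1..DIM('a)}"
  shows "(\<Sum>j\<in>J. c j *\<^sub>R e j) \<bullet> e i = (if i \<in> J then c i else 0)"
proof -
  have "(\<Sum>j\<in>J. c j *\<^sub>R e j) \<bullet> e i = (\<Sum>j\<in>J. if j = i then c i else 0)"
    using assms unfolding inner_sum_left
    by (intro sum.cong) (auto simp: orthonormal_frame_def subset_iff)
  then show ?thesis
    using finite_subset[OF assms(3)] by simp
qed

lemma orthonormal_frame_span_expand:
  fixes e :: "nat \<Rightarrow> 'a::euclidean_space"
  assumes e: "orthonormal_frame e" and k: "k \<le> DIM('a)"
  shows "v \<in> span (e ` {1..k}) \<longleftrightarrow> v = (\<Sum>j=1..k. (v \<bullet> e j) *\<^sub>R e j)"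
proof
  assume "v \<in> span (e ` {1..k})"
  then show "v = (\<Sum>j=1..k. (v \<bullet> e j) *\<^sub>R e j)"
  proof (induction rule: span_induct_alt)
    case (step c x y)
    then obtain i where i: "i \<in> {1..k}" "x = e i"
      by auto
    have "(\<Sum>j=1..k. (e i \<bullet> e j) *\<^sub>R e j) = (\<Sum>j=1..k. if j = i then e i else 0)"
      using e k i by (intro sum.cong) (auto simp: orthonormal_frame_def)
    then have "(\<Sum>j=1..k. (e i \<bullet> e j) *\<^sub>R e j) = e i"
      using i by simp
    then show ?case
      using step i
      by (simp add: inner_add_left scaleR_add_left sum.distrib scaleR_sum_right[symmetric]
          scaleR_scaleR[symmetric] del: scaleR_scaleR)
  qed simp
next
  assume v: "v = (\<Sum>j=1..k. (v \<bullet> e j) *\<^sub>R e j)"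
  show "v \<in> span (e ` {1..k})"
    by (subst v) (intro span_sum span_mul span_base imageI)
qed

lemma orthonormal_frame_expand:
  fixes e :: "nat \<Rightarrow> 'a::euclidean_space"
  assumes e: "orthonormal_frame e"
  shows "v = (\<Sum>j=1..DIM('a). (v \<bullet> e j) *\<^sub>R e j)"
proof -
  have inj: "inj_on e {1..DIM('a)}"
    using e by (metis (mono_tags, lifting) orthonormal_frame_def inj_onI zero_neq_one)
  have "pairwise Linear_Algebra.orthogonal (e ` {1..DIM('a)})"
    using e by (auto simp: pairwise_def Linear_Algebra.orthogonal_def orthonormal_frame_def)
  moreover have "e j \<noteq> 0" if "j \<in> {1..DIM('a)}" for j
    using e that by (metis inner_zero_left orthonormal_frame_def zero_neq_one)
  ultimately have "independent (e ` {1..DIM('a)})"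
    by (intro pairwise_orthogonal_independent) auto
  then have "span (e ` {1..DIM('a)}) = UNIV"
    using card_ge_dim_independent[of "e ` {1..DIM('a)}" UNIV] inj by (auto simp: card_image)
  then show ?thesis
    using orthonormal_frame_span_expand[OF e, of "DIM('a)" v] by simp
qed

lemma flat_lborel_frame:
  fixes e :: "nat \<Rightarrow> 'a::euclidean_space"
  assumes e: "bij_betw e {1..k} B"
  shows "flat_lborel p B =
    distr (\<Pi>\<^sub>M j\<in>{1..k}. lborel) borel (\<lambda>c. p + (\<Sum>j=1..k. c j *\<^sub>R e j))"
proof -
  define t where "t = the_inv_into {1..k} e"
  have t: "bij_betw t B {1..k}"
    unfolding t_def by (rule bij_betw_the_inv_into[OF e])
  have t_mem: "t b \<in> {1..k}" if "b \<in> B" for b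
    using t that by (auto simp: bij_betw_def)
  have t_e: "t (e j) = j" if "j \<in> {1..k}" for j
    using e that unfolding t_def by (simp add: bij_betw_def the_inv_into_f_f)
  have e_mem: "e j \<in> B" if "j \<in> {1..k}" for j
    using e that by (auto simp: bij_betw_def)
  let ?P = "\<Pi>\<^sub>M j\<in>{1..k}. (lborel :: real measure)" and ?PB = "\<Pi>\<^sub>M b\<in>B. (lborel :: real measure)"
  define T :: "(nat \<Rightarrow> real) \<Rightarrow> 'a \<Rightarrow> real" where "T \<omega> = (\<lambda>b\<in>B. \<omega> (t b))" for \<omega>
  define F :: "('a \<Rightarrow> real) \<Rightarrow> 'a" where "F c = p + (\<Sum>b\<in>B. c b *\<^sub>R b)" for c
  have T: "T \<in> ?P \<rightarrow>\<^sub>M ?PB"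
    unfolding T_def using t_mem by (intro measurable_restrict measurable_component_singleton)
  have F: "F \<in> ?PB \<rightarrow>\<^sub>M borel"
    unfolding F_def by measurable
  have "distr ?P ?PB T = ?PB"
    unfolding T_def by (rule PiM_reindex[OF t]) (simp_all add: lborel.sigma_finite_measure_axioms)
  then have "flat_lborel p B = distr (distr ?P ?PB T) borel F"
    unfolding flat_lborel_def F_def by (rule arg_cong[OF sym])
  also have "\<dots> = distr ?P borel (F \<circ> T)"
    by (rule distr_distr[OF F T])
  also have "F \<circ> T = (\<lambda>c. p + (\<Sum>j=1..k. c j *\<^sub>R e j))"
  proof
    show "(F \<circ> T) c = p + (\<Sum>j=1..k. c j *\<^sub>R e j)" for c
      unfolding F_def comp_def T_def sum.reindex_bij_betw[OF e, symmetric]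
      using t_e e_mem by simp
  qed
  finally show ?thesis .
qed

section \<open>The simplex and its prism in coordinates\<close>

lemma convex_hull_insert_0_image:
  fixes x :: "nat \<Rightarrow> 'a::real_vector"
  shows "convex hull (insert 0 (x ` {1..k})) =
    {(\<Sum>j=1..k. c j *\<^sub>R x j) |c. (\<forall>j\<in>{1..k}. 0 \<le> c j) \<and> (\<Sum>j=1..k. c j) \<le> 1}" (is "?L = ?R")
proof
  show "?L \<subseteq> ?R"
  proof (rule hull_minimal)
    have "x i \<in> ?R" if "i \<in> {1..k}" for i
    proof -
      have "(\<Sum>j=1..k. (if j = i then 1 else 0) *\<^sub>R x j) = (\<Sum>j=1..k. if j = i then x i else 0)"
        by (intro sum.cong) auto
      then show ?thesis
        using that by (intro CollectI exI[of _ "\<lambda>j. if j = i then 1 else 0"]) auto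
    qed
    moreover have "0 \<in> ?R"
      by (intro CollectI exI[of _ "\<lambda>_. 0"]) auto
    ultimately show "insert 0 (x ` {1..k}) \<subseteq> ?R"
      by blast
    show "convex ?R"
    proof (rule convexI)
      fix v w and a b :: real
      assume "v \<in> ?R" "w \<in> ?R" and ab: "0 \<le> a" "0 \<le> b" "a + b = 1"
      then obtain c c' where c: "v = (\<Sum>j=1..k. c j *\<^sub>R x j)" "\<forall>j\<in>{1..k}. 0 \<le> c j" "(\<Sum>j=1..k. c j) \<le> 1"
        and c': "w = (\<Sum>j=1..k. c' j *\<^sub>R x j)" "\<forall>j\<in>{1..k}. 0 \<le> c' j" "(\<Sum>j=1..k. c' j) \<le> 1"
        by blast
      have "a * (\<Sum>j=1..k. c j) + b * (\<Sum>j=1..k. c' j) \<le> 1"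
        using ab c(3) c'(3) by (metis convex_bound_le)
      then have "(\<Sum>j=1..k. a * c j + b * c' j) \<le> 1"
        by (simp add: sum.distrib sum_distrib_left)
      moreover have "\<forall>j\<in>{1..k}. 0 \<le> a * c j + b * c' j"
        using c c' ab by simp
      moreover have "a *\<^sub>R v + b *\<^sub>R w = (\<Sum>j=1..k. (a * c j + b * c' j) *\<^sub>R x j)"
        by (simp add: c c' scaleR_sum_right scaleR_add_left sum.distrib)
      ultimately show "a *\<^sub>R v + b *\<^sub>R w \<in> ?R"
        by (intro CollectI exI[of _ "\<lambda>j. a * c j + b * c' j"] conjI)
    qed
  qed
  show "?R \<subseteq> ?L"
  proof safe
    fix c :: "nat \<Rightarrow> real"
    assume c: "\<forall>j\<in>{1..k}. 0 \<le> c j" "(\<Sum>j=1..k. c j) \<le> 1"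
    \<comment> \<open>The missing weight up to 1 is assigned to the vertex 0, which contributes
      nothing to the sum.\<close>
    define a where "a j = (if j = 0 then 1 - (\<Sum>j=1..k. c j) else c j)" for j
    define y where "y j = (if j = 0 then 0 else x j)" for j
    have split: "{0..k} = insert 0 {1..k}"
      by auto
    have "(\<Sum>j\<in>{0..k}. a j *\<^sub>R y j) \<in> ?L"
    proof (rule convex_sum)
      show "(\<Sum>j\<in>{0..k}. a j) = 1"
        unfolding split by (simp add: a_def)
      show "y j \<in> ?L" if "j \<in> {0..k}" for j
        using that by (intro hull_inc) (auto simp: y_def)
    qed (use c in \<open>auto simp: a_def\<close>)
    then show "(\<Sum>j=1..k. c j *\<^sub>R x j) \<in> ?L"
      unfolding split by (simp add: a_def y_def)
  qed
qed

text \<open>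
  A simplex of dimension \<open>k\<close> is thickened to a set of full dimension by a unit cube in the orthogonal
  complement, which leaves the volume unchanged.
\<close>
definition simplex_prism :: "nat \<Rightarrow> nat \<Rightarrow> (nat \<Rightarrow> real) set" where
  "simplex_prism k d = {c \<in> space (\<Pi>\<^sub>M j\<in>{1..d}. lborel).
     (\<forall>j\<in>{1..d}. 0 \<le> c j) \<and> (\<Sum>j=1..k. c j) \<le> 1 \<and> (\<forall>j\<in>{k+1..d}. c j \<le> 1)}"

text \<open>The value is \<open>1 / k!\<close>, but only its positivity is needed.\<close>
definition kappa :: "nat \<Rightarrow> nat \<Rightarrow> real" where
  "kappa k d = measure (\<Pi>\<^sub>M j\<in>{1..d}. lborel) (simplex_prism k d)"

lemma emeasure_PiM_lborel_finite:
  assumes "A \<subseteq> (\<Pi>\<^sub>E j\<in>I. {l..u})" "finite I"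
  shows "emeasure (\<Pi>\<^sub>M j\<in>I. (lborel :: real measure)) A < \<infinity>"
proof -
  interpret product_sigma_finite "\<lambda>_. lborel :: real measure"
    by (simp add: product_sigma_finite_def lborel.sigma_finite_measure_axioms)
  have "emeasure (\<Pi>\<^sub>M j\<in>I. (lborel :: real measure)) A \<le>
      emeasure (\<Pi>\<^sub>M j\<in>I. (lborel :: real measure)) (\<Pi>\<^sub>E j\<in>I. {l..u})"
    using assms by (intro emeasure_mono sets_PiM_I_finite) auto
  also have "\<dots> = (\<Prod>j\<in>I. ennreal (if l \<le> u then u - l else 0))"
    using assms by (subst emeasure_PiM) (auto simp: emeasure_lborel_Icc_eq)
  also have "\<dots> < \<infinity>"
    by (subst prod_ennreal) auto
  finally show ?thesis .
qed

lemma simplex_prism_sets: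
  assumes "k \<le> d"
  shows "simplex_prism k d \<in> sets (\<Pi>\<^sub>M j\<in>{1..d}. lborel)"
proof -
  have [measurable]: "(\<lambda>c. c j) \<in> borel_measurable (\<Pi>\<^sub>M j\<in>{1..d}. (lborel :: real measure))"
    if "j \<in> {1..d}" for j
    using measurable_component_singleton[OF that, of "\<lambda>_. lborel :: real measure"] by simp
  have "(\<lambda>c. \<Sum>j=1..k. c j) \<in> borel_measurable (\<Pi>\<^sub>M j\<in>{1..d}. (lborel :: real measure))"
    using assms by (intro borel_measurable_sum) auto
  note [measurable] = this
  show ?thesis
    unfolding simplex_prism_def
    by (intro sets.sets_Collect_conj sets.sets_Collect_finite_All) (auto intro!: borel_measurable_le)
qed

lemma simplex_prism_subset:
  assumes "k \<le> d"
  shows "simplex_prism k d \<subseteq> (\<Pi>\<^sub>E j\<in>{1..d}. {0..1})"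
proof
  fix c assume c: "c \<in> simplex_prism k d"
  have "c j \<in> {0..1}" if j: "j \<in> {1..d}" for j
  proof (cases "j \<le> k")
    case True
    have "c j \<le> (\<Sum>j=1..k. c j)"
      using c j True assms by (intro member_le_sum) (auto simp: simplex_prism_def)
    then show ?thesis
      using c j by (auto simp: simplex_prism_def)
  qed (use c j in \<open>auto simp: simplex_prism_def\<close>)
  then show "c \<in> (\<Pi>\<^sub>E j\<in>{1..d}. {0..1})"
    using c by (auto simp: simplex_prism_def space_PiM PiE_iff)
qed

lemma kappa_pos:
  assumes k: "k \<le> d"
  shows "kappa k d > 0"
proof (cases "d = 0")
  case True
  then show ?thesis
    using k by (simp add: kappa_def simplex_prism_def PiM_empty space_PiM)
next
  case False
  interpret product_sigma_finite "\<lambda>_. lborel :: real measure"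
    by (simp add: product_sigma_finite_def lborel.sigma_finite_measure_axioms)
  let ?P = "\<Pi>\<^sub>M j\<in>{1..d}. (lborel :: real measure)"
  \<comment> \<open>A cube of side 1/d fits into the prism: at most d coordinates are summed, so the
    sum stays below 1.\<close>
  have "(\<Pi>\<^sub>E j\<in>{1..d}. {0..1 / real d}) \<subseteq> simplex_prism k d"
  proof
    fix c assume c: "c \<in> (\<Pi>\<^sub>E j\<in>{1..d}. {0..1 / real d})"
    have mem: "c j \<in> {0..1 / real d}" if "j \<in> {1..d}" for j
      using c that by (rule PiE_mem)
    have "(\<Sum>j=1..k. c j) \<le> (\<Sum>j=1..k. 1 / real d)"
      using mem k by (intro sum_mono) auto
    also have "\<dots> \<le> 1"
      using k False by (simp add: divide_simps)
    finally have "(\<Sum>j=1..k. c j) \<le> 1" .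
    moreover have "c j \<le> 1" if "j \<in> {k+1..d}" for j
    proof -
      have "1 / real d \<le> 1"
        using False by simp
      moreover have "c j \<le> 1 / real d"
        using mem[of j] that by auto
      ultimately show ?thesis
        by linarith
    qed
    ultimately show "c \<in> simplex_prism k d"
      using mem c by (auto simp: simplex_prism_def space_PiM PiE_iff)
  qed
  then have "emeasure ?P (\<Pi>\<^sub>E j\<in>{1..d}. {0..1 / real d}) \<le> emeasure ?P (simplex_prism k d)"
    using simplex_prism_sets[OF k] by (intro emeasure_mono)
  moreover have "emeasure ?P (\<Pi>\<^sub>E j\<in>{1..d}. {0..1 / real d}) = ennreal ((1 / real d) ^ d)"
    by (subst emeasure_PiM) (auto simp: ennreal_power)
  moreover have "emeasure ?P (simplex_prism k d) < \<infinity>"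
    using simplex_prism_subset[OF k] by (intro emeasure_PiM_lborel_finite) auto
  ultimately have "ennreal ((1 / real d) ^ d) \<le> ennreal (kappa k d)"
    by (simp add: kappa_def emeasure_eq_ennreal_measure)
  moreover have "(1 / real d) ^ d > 0"
    using False by simp
  ultimately show ?thesis
    by (metis ennreal_le_iff2 le_less_trans not_less not_le)
qed

section \<open>Lebesgue measure in frame coordinates and the volume of a flat simplex\<close>

lemma orthonormal_frame_inj:
  fixes e :: "nat \<Rightarrow> 'a::euclidean_space"
  assumes "orthonormal_frame e"
  shows "inj_on e {1..DIM('a)}"
  using assms by (metis (mono_tags, lifting) orthonormal_frame_def inj_onI zero_neq_one)

text \<open>The appended frame vectors are orthogonal to the points and to each other, so
  orthogonalisation leaves them unchanged. They are unit vectors and do not affect the product of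
  norms.\<close>

lemma gs_frame_extension:
  fixes e :: "nat \<Rightarrow> 'a::euclidean_space"
  assumes e: "orthonormal_frame e" and x: "\<And>j. j \<in> {1..k} \<Longrightarrow> x j \<in> span (e ` {1..k})"
    and k: "k \<le> DIM('a)" and j: "j \<in> {1..DIM('a)}"
  shows "gs (\<lambda>j. if j \<le> k then x j else e j) j = (if j \<le> k then gs x j else e j)"
proof (cases "j \<le> k")
  case True
  then show ?thesis
    using j by (auto intro: gs_cong)
next
  case False
  have "e j \<bullet> x i = 0" if "i \<in> {1..k}" for i
  proof -
    have "Linear_Algebra.orthogonal (e j) (x i)"
      by (rule orthogonal_to_span[OF x[OF that]])
        (use e j k False in \<open>auto simp: Linear_Algebra.orthogonal_def orthonormal_frame_def\<close>)
    then show ?thesis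
      by (simp add: Linear_Algebra.orthogonal_def)
  qed
  moreover have "e j \<bullet> e i = 0" if "1 \<le> i" "i < j" for i
    using e that j by (auto simp: orthonormal_frame_def)
  ultimately show ?thesis
    using False by (subst gs_eq_self) auto
qed

text \<open>Rotation invariance of Lebesgue measure, as a special case of
  \<open>measure_linear_combinations\<close>: an orthonormal frame is its own orthogonalisation and
  all norms are 1. The formula is applied to the preimage of a box.\<close>

lemma lborel_eq_distr_frame:
  fixes e :: "nat \<Rightarrow> real ^ 'n"
  assumes e: "orthonormal_frame e"
  shows "(lborel :: (real^'n) measure) =
    distr (\<Pi>\<^sub>M j\<in>{1..CARD('n)}. lborel) borel (\<lambda>c. \<Sum>j=1..CARD('n). c j *\<^sub>R e j)"
proof (rule lborel_eqI)
  let ?d = "CARD('n)"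
  let ?P = "\<Pi>\<^sub>M j\<in>{1..?d}. (lborel :: real measure)"
  let ?f = "\<lambda>c. \<Sum>j=1..?d. c j *\<^sub>R e j"
  have f_inner: "?f c \<bullet> e j = c j" if "j \<in> {1..?d}" for c j
    using orthonormal_frame_inner_sum[OF e, of j "{1..?d}" c] that by simp
  have norm_e: "norm (e j) = 1" if "j \<in> {1..?d}" for j
    using e that by (simp add: orthonormal_frame_def norm_eq_sqrt_inner)
  have gs_e: "gs e j = e j" if "j \<in> {1..?d}" for j
    using e that by (intro gs_eq_self) (auto simp: orthonormal_frame_def)
  have comp: "(\<lambda>c. c j) \<in> borel_measurable ?P" if "j \<in> {1..?d}" for j
    using measurable_component_singleton[OF that, of "\<lambda>_. lborel :: real measure"] by simp
  have f_meas: "?f \<in> borel_measurable ?P"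
    by (intro borel_measurable_sum borel_measurable_scaleR comp) auto
  fix l u :: "real^'n"
  assume lu: "\<And>b. b \<in> Basis \<Longrightarrow> l \<bullet> b \<le> u \<bullet> b"
  define Q where "Q = ?f -` box l u \<inter> space ?P"
  have Q_sets: "Q \<in> sets ?P"
    unfolding Q_def by (rule measurable_sets[OF f_meas]) simp
  obtain R where R: "\<And>v. v \<in> box l u \<Longrightarrow> norm v \<le> R"
    using bounded_box[of l u] by (auto simp: bounded_iff)
  \<comment> \<open>The coordinates of a point in a frame are bounded by its norm, so the preimage
    of a bounded box has finite measure.\<close>
  have "c j \<in> {-R..R}" if "c \<in> Q" "j \<in> {1..?d}" for c j
    using Cauchy_Schwarz_ineq2[of "?f c" "e j"] R[of "?f c"] f_inner[of j c] norm_e[of j] that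
    by (auto simp: Q_def abs_le_iff)
  then have "Q \<subseteq> (\<Pi>\<^sub>E j\<in>{1..?d}. {-R..R})"
    by (intro subsetI PiE_I) (auto simp: Q_def space_PiM PiE_iff extensional_def)
  then have Q_finite: "emeasure ?P Q < \<infinity>"
    by (intro emeasure_PiM_lborel_finite) auto
  have image: "?f ` Q = box l u"
  proof (intro equalityI subsetI)
    fix v assume "v \<in> box l u"
    moreover have "?f (\<lambda>j\<in>{1..?d}. v \<bullet> e j) = v"
      using orthonormal_frame_expand[OF e, of v] by simp
    ultimately show "v \<in> ?f ` Q"
      by (intro image_eqI[of _ _ "\<lambda>j\<in>{1..?d}. v \<bullet> e j"]) (auto simp: Q_def space_PiM)
  qed (auto simp: Q_def)
  have "measure lborel (box l u) = measure ?P Q"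
    using measure_linear_combinations[OF Q_sets Q_finite, of e] by (simp add: image gs_e norm_e)
  moreover have "emeasure (distr ?P borel ?f) (box l u) = emeasure ?P Q"
    using f_meas by (simp add: emeasure_distr Q_def)
  ultimately have "emeasure (distr ?P borel ?f) (box l u) = ennreal (measure lborel (box l u))"
    using Q_finite by (simp add: emeasure_eq_ennreal_measure)
  then show "emeasure (distr ?P borel ?f) (box l u) = (\<Prod>b\<in>Basis. (u - l) \<bullet> b)"
    using lu by (simp add: emeasure_eq_ennreal_measure[symmetric])
qed simp

text \<open>The right side mentions neither p nor B, so the chosen flat is irrelevant. The prism
  over S is measured twice. In frame coordinates it is F times a unit cube, and F has the flat
  measure of S. As a linear image of \<open>simplex_prism\<close>, spanned by the points and the
  complementary frame vectors, it has measure \<open>kappa\<close> times the Gram--Schmidt norms. If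
  the points are dependent, both values are 0 without a separate argument.\<close>

lemma measure_flat_simplex:
  fixes x :: "nat \<Rightarrow> real ^ 'n" and k :: nat
  defines "S \<equiv> convex hull (insert 0 (x ` {1..k}))"
  assumes B: "orthonormal_set B" "card B = k" and S: "S \<subseteq> (\<lambda>y. p + y) ` span B"
  shows "measure (flat_lborel p B) S = kappa k CARD('n) * (\<Prod>j=1..k. norm (gs x j))"
proof -
  let ?d = "CARD('n)"
  let ?P = "\<Pi>\<^sub>M j\<in>{1..?d}. (lborel :: real measure)"
  let ?P1 = "\<Pi>\<^sub>M j\<in>{1..k}. (lborel :: real measure)"
  let ?P2 = "\<Pi>\<^sub>M j\<in>{k+1..?d}. (lborel :: real measure)"
  interpret product_sigma_finite "\<lambda>_. lborel :: real measure"
    by (simp add: product_sigma_finite_def lborel.sigma_finite_measure_axioms)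
  obtain e where e: "orthonormal_frame e" "bij_betw e {1..k} B" and k: "k \<le> ?d"
    using orthonormal_set_extend[OF B(1)] B(2) by auto
  have span_B: "span B = span (e ` {1..k})"
    using e(2) by (simp add: bij_betw_def)
  \<comment> \<open>The vertex 0 belongs to S, so the affine flat passes through the origin and is
    span B itself.\<close>
  have p: "p \<in> span (e ` {1..k})"
  proof -
    have "0 \<in> S"
      by (simp add: S_def hull_inc)
    then obtain y where "y \<in> span B" "0 = p + y"
      using S by blast
    then have "p = - y" "y \<in> span B"
      by (simp_all add: eq_neg_iff_add_eq_0)
    then show ?thesis
      by (simp add: span_B span_neg)
  qed
  have S_span: "S \<subseteq> span (e ` {1..k})"
    using S p by (auto simp: span_B span_add)
  have x_span: "x j \<in> span (e ` {1..k})" if "j \<in> {1..k}" for j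
  proof -
    have "x j \<in> S"
      unfolding S_def using that by (intro hull_inc) auto
    then show ?thesis
      using S_span by blast
  qed
  have S_compact: "compact S"
    unfolding S_def by (intro finite_imp_compact_convex_hull) auto
  have frame_inner: "(\<Sum>j\<in>J. c j *\<^sub>R e j) \<bullet> e i = (if i \<in> J then c i else 0)"
    if "i \<in> {1..?d}" "J \<subseteq> {1..?d}" for i J c
    using orthonormal_frame_inner_sum[OF e(1)] that by simp
  have sum_split: "(\<Sum>j=1..?d. f j) = (\<Sum>j=1..k. f j) + (\<Sum>j=k+1..?d. f j)" for f :: "nat \<Rightarrow> real^'n"
    using k by (subst sum.union_disjoint[symmetric]) (auto intro!: sum.cong)
  \<comment> \<open>The prism, that is S plus the unit cube in the complement, is
    \<open>p + A\<close>. Splitting off p makes the frame coordinates of A those in which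
    \<open>flat_lborel p B\<close> is defined; translation invariance removes p at the end.\<close>
  define A where "A = {v. p + (\<Sum>j=1..k. (v \<bullet> e j) *\<^sub>R e j) \<in> S \<and> (\<forall>j\<in>{k+1..?d}. v \<bullet> e j \<in> {0..1})}"
  define X where "X j = (if j \<le> k then x j else e j)" for j
  define Q where "Q = {c \<in> space ?P. p + (\<Sum>j=1..k. c j *\<^sub>R e j) \<in> S \<and> (\<forall>j\<in>{k+1..?d}. c j \<in> {0..1})}"
  define F where "F = {c \<in> space ?P1. p + (\<Sum>j=1..k. c j *\<^sub>R e j) \<in> S}"
  have A_borel: "A \<in> sets borel"
  proof -
    have "closed {v. p + (\<Sum>j=1..k. (v \<bullet> e j) *\<^sub>R e j) \<in> S}"
      using continuous_closed_vimage[of S "\<lambda>v. p + (\<Sum>j=1..k. (v \<bullet> e j) *\<^sub>R e j)"]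
        compact_imp_closed[OF S_compact]
      by (auto simp: vimage_def intro!: continuous_intros)
    moreover have "closed {v. v \<bullet> e j \<in> {0..1}}" for j
      using continuous_closed_vimage[of "{0..1}" "\<lambda>v. v \<bullet> e j"]
      by (auto simp: vimage_def intro!: continuous_intros)
    moreover have "A = {v. p + (\<Sum>j=1..k. (v \<bullet> e j) *\<^sub>R e j) \<in> S} \<inter>
        (\<Inter>j\<in>{k+1..?d}. {v. v \<bullet> e j \<in> {0..1}})"
      by (auto simp: A_def)
    ultimately have "closed A"
      by (metis (no_types, lifting) closed_Int closed_INT)
    then show ?thesis
      by simp
  qed
  have comp[measurable]: "(\<lambda>c. c j) \<in> borel_measurable ?P" if "j \<in> {1..?d}" for j
    using measurable_component_singleton[OF that, of "\<lambda>_. lborel :: real measure"] by simp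
  have comp1[measurable]: "(\<lambda>c. c j) \<in> borel_measurable ?P1" if "j \<in> {1..k}" for j
    using measurable_component_singleton[OF that, of "\<lambda>_. lborel :: real measure"] by simp
  have map_meas: "(\<lambda>c. p + (\<Sum>j=1..k. c j *\<^sub>R e j)) \<in> borel_measurable ?P"
    using k by (intro borel_measurable_add borel_measurable_sum borel_measurable_scaleR comp) auto
  have map_meas1: "(\<lambda>c. p + (\<Sum>j=1..k. c j *\<^sub>R e j)) \<in> borel_measurable ?P1"
    by (intro borel_measurable_add borel_measurable_sum borel_measurable_scaleR comp1) auto
  have S_borel: "S \<in> sets borel"
    using S_compact by (simp add: borel_compact)
  have Q_sets: "Q \<in> sets ?P"
  proof -
    have "{c \<in> space ?P. p + (\<Sum>j=1..k. c j *\<^sub>R e j) \<in> S} \<in> sets ?P"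
      using measurable_sets[OF map_meas S_borel] by (simp add: vimage_def Int_def conj_commute)
    moreover have "{c \<in> space ?P. c j \<in> {0..1}} \<in> sets ?P" if "j \<in> {k+1..?d}" for j
      using measurable_sets[OF comp, of j "{0..1}"] that by (simp add: vimage_def Int_def conj_commute)
    ultimately show ?thesis
      unfolding Q_def by (intro sets.sets_Collect_conj sets.sets_Collect_finite_All) auto
  qed
  have F_sets: "F \<in> sets ?P1"
    using measurable_sets[OF map_meas1 S_borel] by (simp add: F_def vimage_def Int_def conj_commute)
  have prism_image: "(\<lambda>c. \<Sum>j=1..?d. c j *\<^sub>R X j) ` simplex_prism k ?d = (\<lambda>v. p + v) ` A"
  proof (intro equalityI subsetI)
    fix v assume "v \<in> (\<lambda>c. \<Sum>j=1..?d. c j *\<^sub>R X j) ` simplex_prism k ?d"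
    then obtain c where c: "c \<in> simplex_prism k ?d" "v = (\<Sum>j=1..?d. c j *\<^sub>R X j)"
      by blast
    define y where "y = (\<Sum>j=1..k. c j *\<^sub>R x j)"
    have yS: "y \<in> S"
      unfolding S_def convex_hull_insert_0_image y_def using c(1) k by (auto simp: simplex_prism_def)
    then have "y - p \<in> span (e ` {1..k})"
      using S_span p by (auto intro: span_diff)
    \<comment> \<open>Both y and p lie in the span of the first k frame vectors, so y - p has no
      component along the complementary ones and the cube coordinates are exactly the remaining c
      j.\<close>
    then have yp: "y - p = (\<Sum>j=1..k. ((y - p) \<bullet> e j) *\<^sub>R e j)"
      using orthonormal_frame_span_expand[OF e(1), of k] k by simp
    have v: "v - p = (\<Sum>j=1..k. ((y - p) \<bullet> e j) *\<^sub>R e j) + (\<Sum>j=k+1..?d. c j *\<^sub>R e j)"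
      unfolding c(2) sum_split yp[symmetric] by (simp add: X_def y_def)
    have "(v - p) \<bullet> e i = (if i \<le> k then (y - p) \<bullet> e i else c i)" if "i \<in> {1..?d}" for i
      using frame_inner[OF that, of "{1..k}" "\<lambda>j. (y - p) \<bullet> e j"]
        frame_inner[OF that, of "{k+1..?d}" c] that k by (subst v) (auto simp: inner_add_left)
    then have "v - p \<in> A"
      using yS yp c(1) k by (auto simp: A_def simplex_prism_def)
    then show "v \<in> (\<lambda>v. p + v) ` A"
      by (intro image_eqI[of _ _ "v - p"]) auto
  next
    fix v assume "v \<in> (\<lambda>v. p + v) ` A"
    then obtain w where w: "v = p + w" "w \<in> A"
      by blast
    then obtain c where c: "p + (\<Sum>j=1..k. (w \<bullet> e j) *\<^sub>R e j) = (\<Sum>j=1..k. c j *\<^sub>R x j)"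
      "\<forall>j\<in>{1..k}. 0 \<le> c j" "(\<Sum>j=1..k. c j) \<le> 1"
      unfolding A_def S_def convex_hull_insert_0_image by blast
    define c' where "c' = (\<lambda>j\<in>{1..?d}. if j \<le> k then c j else w \<bullet> e j)"
    have "w = (\<Sum>j=1..k. (w \<bullet> e j) *\<^sub>R e j) + (\<Sum>j=k+1..?d. (w \<bullet> e j) *\<^sub>R e j)"
      using orthonormal_frame_expand[OF e(1), of w] sum_split[of "\<lambda>j. (w \<bullet> e j) *\<^sub>R e j"] by simp
    then have "v = (\<Sum>j=1..k. c j *\<^sub>R x j) + (\<Sum>j=k+1..?d. (w \<bullet> e j) *\<^sub>R e j)"
      unfolding w(1) c(1)[symmetric] by (simp add: add.assoc)
    also have "\<dots> = (\<Sum>j=1..?d. c' j *\<^sub>R X j)"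
      unfolding sum_split using k by (intro arg_cong2[of _ _ _ _ plus] sum.cong) (auto simp: c'_def X_def)
    finally have "v = (\<Sum>j=1..?d. c' j *\<^sub>R X j)" .
    moreover have "c' \<in> simplex_prism k ?d"
    proof -
      have "(\<Sum>j=1..k. c' j) = (\<Sum>j=1..k. c j)"
        using k by (intro sum.cong) (auto simp: c'_def)
      moreover have "0 \<le> c' j" if "j \<in> {1..?d}" for j
        using that c(2) w(2) by (auto simp: c'_def A_def)
      moreover have "c' j \<le> 1" if "j \<in> {k+1..?d}" for j
        using that w(2) by (auto simp: c'_def A_def)
      ultimately show ?thesis
        using c(3) by (auto simp: simplex_prism_def space_PiM c'_def)
    qed
    ultimately show "v \<in> (\<lambda>c. \<Sum>j=1..?d. c j *\<^sub>R X j) ` simplex_prism k ?d"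
      by blast
  qed
  have pA_borel: "(\<lambda>v. p + v) ` A \<in> sets borel"
  proof -
    have "(\<lambda>v. p + v) ` A = (\<lambda>v. v - p) -` A"
      by (auto simp: image_iff intro!: bexI[of _ "_ - p"])
    then show ?thesis
      using measurable_sets[of "\<lambda>v. v - p" borel borel A] A_borel by simp
  qed
  have norm_e: "norm (e j) = 1" if "j \<in> {1..?d}" for j
    using e(1) that by (simp add: orthonormal_frame_def norm_eq_sqrt_inner)
  have "measure lborel A = measure ?P Q"
  proof -
    have meas: "(\<lambda>c. \<Sum>j=1..?d. c j *\<^sub>R e j) \<in> borel_measurable ?P"
      by (intro borel_measurable_sum borel_measurable_scaleR comp) auto
    have "(\<lambda>c. \<Sum>j=1..?d. c j *\<^sub>R e j) -` A \<inter> space ?P = Q"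
      using frame_inner[of _ "{1..?d}"] k by (auto simp: A_def Q_def)
    then show ?thesis
      by (subst lborel_eq_distr_frame[OF e(1)]) (simp add: measure_distr[OF meas] A_borel)
  qed
  moreover have "measure lborel ((\<lambda>v. p + v) ` A) = (\<Prod>j=1..k. norm (gs x j)) * kappa k ?d"
  proof -
    have "measure lborel ((\<lambda>v. p + v) ` A) = (\<Prod>j=1..?d. norm (gs X j)) * kappa k ?d"
      using measure_linear_combinations[OF simplex_prism_sets[OF k], of X]
        emeasure_PiM_lborel_finite[OF simplex_prism_subset[OF k]] pA_borel
      by (simp add: prism_image kappa_def)
    also have "(\<Prod>j=1..?d. norm (gs X j)) = (\<Prod>j=1..k. norm (gs x j))"
      using gs_frame_extension[OF e(1), of k x] x_span k norm_e
      by (intro prod.mono_neutral_cong_right) (auto simp: X_def[abs_def])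
    finally show ?thesis .
  qed
  moreover have "measure lborel ((\<lambda>v. p + v) ` A) = measure lborel A"
    using measure_translation[of p A] A_borel pA_borel by simp
  \<comment> \<open>By Tonelli, the complementary coordinates range over a unit cube and contribute
    the factor 1.\<close>
  moreover have "emeasure ?P Q = emeasure ?P1 F"
  proof -
    have un: "{1..?d} = {1..k} \<union> {k+1..?d}" and disj: "{1..k} \<inter> {k+1..?d} = {}"
      using k by auto
    have "emeasure ?P Q = (\<integral>\<^sup>+c. indicator Q c \<partial>?P)"
      using Q_sets by simp
    also have "\<dots> = (\<integral>\<^sup>+a. \<integral>\<^sup>+b. indicator Q (merge {1..k} {k+1..?d} (a, b)) \<partial>?P2 \<partial>?P1)"
      using Q_sets unfolding un by (intro product_nn_integral_fold[OF disj]) auto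
    also have "\<dots> = (\<integral>\<^sup>+a. \<integral>\<^sup>+b. indicator F a * indicator (\<Pi>\<^sub>E j\<in>{k+1..?d}. {0..1}) b \<partial>?P2 \<partial>?P1)"
    proof (intro nn_integral_cong)
      fix a b assume a: "a \<in> space ?P1" and b: "b \<in> space ?P2"
      have "(\<Sum>j=1..k. merge {1..k} {k+1..?d} (a, b) j *\<^sub>R e j) = (\<Sum>j=1..k. a j *\<^sub>R e j)"
        by (intro sum.cong) (auto simp: merge_def)
      moreover have "merge {1..k} {k+1..?d} (a, b) j = b j" if "j \<in> {k+1..?d}" for j
        using that by (simp add: merge_def)
      moreover have "merge {1..k} {k+1..?d} (a, b) \<in> space ?P"
        using a b unfolding un by (simp add: space_PiM PiE_iff)
      ultimately have "merge {1..k} {k+1..?d} (a, b) \<in> Q \<longleftrightarrow> a \<in> F \<and> b \<in> (\<Pi>\<^sub>E j\<in>{k+1..?d}. {0..1})"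
        using a b by (simp add: Q_def F_def space_PiM PiE_iff)
      then show "indicator Q (merge {1..k} {k+1..?d} (a, b)) =
          (indicator F a * indicator (\<Pi>\<^sub>E j\<in>{k+1..?d}. {0..1}) b :: ennreal)"
        by (simp add: indicator_def)
    qed
    also have "\<dots> = (\<integral>\<^sup>+a. indicator F a * emeasure ?P2 (\<Pi>\<^sub>E j\<in>{k+1..?d}. {0..1}) \<partial>?P1)"
      by (intro nn_integral_cong) (simp add: nn_integral_cmult sets_PiM_I_finite)
    also have "emeasure ?P2 (\<Pi>\<^sub>E j\<in>{k+1..?d}. {0..1}) = 1"
      by (subst emeasure_PiM) auto
    finally show ?thesis
      using F_sets by simp
  qed
  moreover have "measure (flat_lborel p B) S = measure ?P1 F"
  proof -
    have "(\<lambda>c. p + (\<Sum>j=1..k. c j *\<^sub>R e j)) -` S \<inter> space ?P1 = F"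
      by (auto simp: F_def)
    then show ?thesis
      unfolding flat_lborel_frame[OF e(2)] by (simp add: measure_distr[OF map_meas1] S_borel)
  qed
  ultimately show ?thesis
    by (simp add: measure_def mult.commute)
qed

text \<open>A flat containing the simplex exists because the span of the points has dimension at
  most k and can be enlarged within a frame to dimension exactly k. Whatever \<open>SOME\<close>
  returns then comes from some admissible pair, and all of these have the same value.\<close>

lemma flat_volume_simplex:
  fixes x :: "nat \<Rightarrow> real ^ 'n"
  assumes k: "k \<le> CARD('n)"
  shows "flat_volume k (convex hull (insert 0 (x ` {1..k}))) =
    kappa k CARD('n) * (\<Prod>j=1..k. norm (gs x j))"
proof -
  let ?S = "convex hull (insert 0 (x ` {1..k}))"
  have "dim (span (x ` {1..k})) \<le> k"
    using dim_le_card'[of "x ` {1..k}"] card_image_le[of "{1..k}" x] by simp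
  then obtain e m where e: "orthonormal_frame e" "span (x ` {1..k}) = span (e ` {1..m})" "m \<le> k"
    using subspace_orthonormal_frame[OF subspace_span, of "x ` {1..k}"] by metis
  have "x ` {1..k} \<subseteq> span (x ` {1..k})"
    by (rule span_superset)
  also have "\<dots> \<subseteq> span (e ` {1..k})"
    unfolding e(2) using e(3) by (intro span_mono image_mono) auto
  finally have "?S \<subseteq> span (e ` {1..k})"
    by (intro hull_minimal) (auto intro: span_zero subspace_imp_convex subspace_span)
  moreover have inj: "inj_on e {1..k}"
    using orthonormal_frame_inj[OF e(1)] k by (auto elim: inj_on_subset)
  then have "card (e ` {1..k}) = k"
    by (simp add: card_image)
  moreover have "orthonormal_set (e ` {1..k})"
    using e(1) k by (auto simp: orthonormal_set_def pairwise_def orthonormal_frame_def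
        Linear_Algebra.orthogonal_def norm_eq_sqrt_inner)
  ultimately have "\<exists>v p B. orthonormal_set B \<and> card B = k \<and> ?S \<subseteq> (\<lambda>y. p + y) ` span B \<and>
        v = measure (flat_lborel p B) ?S"
    by (intro exI[of _ 0] exI[of _ "e ` {1..k}"] exI) auto
  from someI_ex[OF this] obtain p B where "orthonormal_set B" "card B = k"
      "?S \<subseteq> (\<lambda>y. p + y) ` span B" "flat_volume k ?S = measure (flat_lborel p B) ?S"
    unfolding flat_volume_def by blast
  then show ?thesis
    using measure_flat_simplex by metis
qed

section \<open>Integrability of powers of the volume\<close>

text \<open>
  With the value \<open>\<infinity>\<close> at \<open>0\<close>, unlike \<open>powr\<close>, a finite integral also shows that the argument vanishes
  only on a null set.
\<close>
definition epowr :: "real \<Rightarrow> real \<Rightarrow> ennreal" where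
  "epowr t \<gamma> = (if t = 0 then \<infinity> else ennreal (t powr \<gamma>))"

lemma epowr_measurable [measurable]: "(\<lambda>t. epowr t \<gamma>) \<in> borel_measurable borel"
  unfolding epowr_def by measurable

text \<open>In extended reals 0 times \<infinity> is 0, so a product with an infinite factor is
  infinite only if no factor vanishes.\<close>

lemma epowr_neq_0: "t \<ge> 0 \<Longrightarrow> epowr t \<gamma> \<noteq> 0"
  by (auto simp: epowr_def)

lemma nn_integral_epowr_finite:
  assumes "\<gamma> > - 1"
  shows "(\<integral>\<^sup>+t. epowr \<bar>t\<bar> \<gamma> * indicator {-1..1} t \<partial>lborel) < \<infinity>"
proof -
  define f :: "real \<Rightarrow> ennreal" where "f t = epowr t \<gamma> * indicator {0..1} t" for t
  have f_meas [measurable]: "f \<in> borel_measurable borel"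
    unfolding f_def by measurable
  have "((\<lambda>t. t powr \<gamma>) has_integral (1 / (\<gamma> + 1))) {0..1::real}"
    using has_integral_powr_from_0[OF assms, of 1] by simp
  then have "(\<integral>\<^sup>+t. ennreal (indicator {0..1} t * t powr \<gamma>) \<partial>lborel) = ennreal (1 / (\<gamma> + 1))"
    by (intro nn_integral_has_integral_lebesgue) auto
  moreover have "(\<integral>\<^sup>+t. f t \<partial>lborel) = (\<integral>\<^sup>+t. ennreal (indicator {0..1} t * t powr \<gamma>) \<partial>lborel)"
  proof (rule nn_integral_cong_AE)
    \<comment> \<open>The infinite value sits at the single point 0, which is a null set.\<close>
    show "AE t in lborel. f t = ennreal (indicator {0..1} t * t powr \<gamma>)"
      using AE_lborel_singleton[of "0::real"]
      by eventually_elim (auto simp: f_def epowr_def indicator_def)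
  qed
  ultimately have f_int: "(\<integral>\<^sup>+t. f t \<partial>lborel) < \<infinity>"
    by simp
  have "(\<integral>\<^sup>+t. f (- t) \<partial>lborel) = (\<integral>\<^sup>+t. f t \<partial>distr lborel borel uminus)"
    by (subst nn_integral_distr) auto
  then have f_int': "(\<integral>\<^sup>+t. f (- t) \<partial>lborel) < \<infinity>"
    using f_int by (simp add: lborel_distr_uminus)
  have "(\<integral>\<^sup>+t. epowr \<bar>t\<bar> \<gamma> * indicator {-1..1} t \<partial>lborel) \<le> (\<integral>\<^sup>+t. f t + f (- t) \<partial>lborel)"
    by (intro nn_integral_mono) (auto simp: f_def indicator_def)
  also have "\<dots> = (\<integral>\<^sup>+t. f t \<partial>lborel) + (\<integral>\<^sup>+t. f (- t) \<partial>lborel)"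
    by (intro nn_integral_add) auto
  also have "\<dots> < \<infinity>"
    using f_int f_int' by simp
  finally show ?thesis .
qed

text \<open>Frame coordinates turn Lebesgue measure into a product measure, over which a product of
  functions of single coordinates integrates factor by factor.\<close>

lemma nn_integral_lborel_frame_prod:
  fixes e :: "nat \<Rightarrow> real ^ 'n" and f :: "nat \<Rightarrow> real \<Rightarrow> ennreal"
  assumes e: "orthonormal_frame e"
    and f: "\<And>j. j \<in> {1..CARD('n)} \<Longrightarrow> f j \<in> borel_measurable borel"
  shows "(\<integral>\<^sup>+v. (\<Prod>j=1..CARD('n). f j (v \<bullet> e j)) \<partial>lborel) =
    (\<Prod>j=1..CARD('n). \<integral>\<^sup>+t. f j t \<partial>lborel)"
proof -
  let ?P = "\<Pi>\<^sub>M j\<in>{1..CARD('n)}. (lborel :: real measure)"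
  let ?F = "\<lambda>c. \<Sum>j=1..CARD('n). c j *\<^sub>R e j"
  interpret product_sigma_finite "\<lambda>_. lborel :: real measure"
    by (simp add: product_sigma_finite_def lborel.sigma_finite_measure_axioms)
  have comp: "(\<lambda>c. c j) \<in> borel_measurable ?P" if "j \<in> {1..CARD('n)}" for j
    using measurable_component_singleton[OF that, of "\<lambda>_. lborel :: real measure"] by simp
  have F: "?F \<in> borel_measurable ?P"
    by (intro borel_measurable_sum borel_measurable_scaleR comp) auto
  have G: "(\<lambda>v. \<Prod>j=1..CARD('n). f j (v \<bullet> e j)) \<in> borel_measurable borel"
  proof (intro borel_measurable_prod_ennreal)
    fix j assume j: "j \<in> {1..CARD('n)}"
    have "(\<lambda>v. v \<bullet> e j) \<in> borel_measurable borel"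
      by simp
    from measurable_compose[OF this f[OF j]]
    show "(\<lambda>v. f j (v \<bullet> e j)) \<in> borel_measurable borel" .
  qed
  have "(\<integral>\<^sup>+v. (\<Prod>j=1..CARD('n). f j (v \<bullet> e j)) \<partial>lborel) =
      (\<integral>\<^sup>+c. (\<Prod>j=1..CARD('n). f j (?F c \<bullet> e j)) \<partial>?P)"
    by (subst lborel_eq_distr_frame[OF e], subst nn_integral_distr[OF F]) (use G in simp_all)
  also have "\<dots> = (\<integral>\<^sup>+c. (\<Prod>j=1..CARD('n). f j (c j)) \<partial>?P)"
    using orthonormal_frame_inner_sum[OF e, of _ "{1..CARD('n)}"]
    by (intro nn_integral_cong prod.cong) simp_all
  also have "\<dots> = (\<Prod>j=1..CARD('n). \<integral>\<^sup>+t. f j t \<partial>lborel)"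
    using f by (intro product_nn_integral_prod) auto
  finally show ?thesis .
qed

lemma epowr_norm_le_prod:
  fixes v :: "'a::euclidean_space"
  assumes "finite I" "I \<noteq> {}" "\<beta> \<le> 0" and le: "\<And>i. i \<in> I \<Longrightarrow> \<bar>t i\<bar> \<le> norm v"
  shows "epowr (norm v) \<beta> \<le> (\<Prod>i\<in>I. epowr \<bar>t i\<bar> (\<beta> / card I))"
proof (cases "\<exists>i\<in>I. t i = 0")
  case True
  \<comment> \<open>A vanishing t i makes its factor infinite, and no other factor is 0, so the
    bound is trivial.\<close>
  then have "(\<Prod>i\<in>I. epowr \<bar>t i\<bar> (\<beta> / card I)) = \<infinity>"
    using assms(1) epowr_neq_0 by (simp add: infinity_ennreal_def ennreal_prod_eq_top) (auto simp: epowr_def infinity_ennreal_def)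
  then show ?thesis
    by simp
next
  case False
  then have v: "norm v > 0"
    using assms(2) le by fastforce
  have card: "card I > 0"
    using assms by (simp add: card_gt_0_iff)
  have "norm v powr \<beta> = (\<Prod>i\<in>I. norm v powr (\<beta> / card I))"
    using card v by (simp add: powr_power)
  also have "\<dots> \<le> (\<Prod>i\<in>I. \<bar>t i\<bar> powr (\<beta> / card I))"
    using False le assms(3) by (intro prod_mono conjI powr_mono2') (auto simp: divide_nonpos_nonneg)
  finally show ?thesis
    using v False by (simp add: epowr_def prod_ennreal ennreal_leI)
qed

text \<open>For the point number m + 1 there are d - m frame directions orthogonal to the m points
  before it, and the exponent is shared equally among them. Each of the other m coordinates only
  ranges over [-1, 1] and contributes its length 2.\<close>

definition slice_bound :: "nat \<Rightarrow> nat \<Rightarrow> real \<Rightarrow> ennreal" where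
  "slice_bound d m \<beta> = 2 ^ m *
     (\<integral>\<^sup>+t. epowr \<bar>t\<bar> (\<beta> / real (d - m)) * indicator {-1..1} t \<partial>lborel) ^ (d - m)"

lemma slice_bound_finite:
  assumes "m < d" "\<beta> > - real (d - m)"
  shows "slice_bound d m \<beta> < \<infinity>"
proof -
  have "\<beta> / real (d - m) > - 1"
    using assms by (simp add: divide_simps)
  then show ?thesis
    using nn_integral_epowr_finite unfolding slice_bound_def
    by (auto simp: ennreal_mult_less_top power_less_top_ennreal)
qed

text \<open>The bound is uniform in the preceding points, so it can be pulled out of the integral
  over them.\<close>

lemma nn_integral_gs_slice:
  fixes x :: "nat \<Rightarrow> real ^ 'n"
  assumes m: "m < CARD('n)" and \<beta>: "\<beta> \<le> 0"
  shows "(\<integral>\<^sup>+y. epowr (norm (gs (x(Suc m := y)) (Suc m))) \<beta> * indicator (cball 0 1) y \<partial>lborel)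
    \<le> slice_bound CARD('n) m \<beta>"
proof -
  let ?d = "CARD('n)"
  have "dim (span (x ` {1..m})) \<le> m"
    using dim_le_card'[of "x ` {1..m}"] card_image_le[of "{1..m}" x] by simp
  \<comment> \<open>The span may have dimension r < m. Using only the frame vectors m + 1, ..., d in
    every case keeps the exponent and the bound independent of x.\<close>
  then obtain e r where e: "orthonormal_frame e" "span (x ` {1..m}) = span (e ` {1..r})" "r \<le> m"
    using subspace_orthonormal_frame[OF subspace_span, of "x ` {1..m}"] by metis
  have norm_e: "norm (e j) = 1" if "j \<in> {1..?d}" for j
    using e(1) that by (simp add: orthonormal_frame_def norm_eq_sqrt_inner)
  have orth: "w \<bullet> e j = 0" if w: "w \<in> span (x ` {1..m})" and j: "j \<in> {m+1..?d}" for w j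
  proof -
    have "Linear_Algebra.orthogonal (e j) w"
      using w unfolding e(2)
      by (rule orthogonal_to_span)
        (use e(1,3) j in \<open>auto simp: Linear_Algebra.orthogonal_def orthonormal_frame_def\<close>)
    then show ?thesis
      by (simp add: Linear_Algebra.orthogonal_def inner_commute)
  qed
  \<comment> \<open>The unit ball is enlarged to the cube of side 2 aligned with the frame, which
    turns the integrand into a product.\<close>
  define f :: "nat \<Rightarrow> real \<Rightarrow> ennreal" where
    "f j t = (if j \<le> m then 1 else epowr \<bar>t\<bar> (\<beta> / real (?d - m))) * indicator {-1..1} t" for j t
  have "epowr (norm (gs (x(Suc m := y)) (Suc m))) \<beta> * indicator (cball 0 1) y \<le>
      (\<Prod>j=1..?d. f j (y \<bullet> e j))" for y
  proof (cases "y \<in> cball 0 1")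
    case True
    define g where "g = gs (x(Suc m := y)) (Suc m)"
    have y_e: "\<bar>y \<bullet> e j\<bar> \<le> norm g" if j: "j \<in> {m+1..?d}" for j
    proof -
      have "gs (x(Suc m := y)) i \<bullet> e j = 0" if i: "1 \<le> i" "i < Suc m" for i
      proof -
        have "gs (x(Suc m := y)) i = gs x i"
          using i by (intro gs_cong) auto
        moreover have "gs x i \<in> span (x ` {1..m})"
          by (rule subsetD[OF span_mono gs_in_span]) (use i in auto)
        ultimately show ?thesis
          using orth j by simp
      qed
      then have "g \<bullet> e j = y \<bullet> e j"
        unfolding g_def by (subst inner_gs) auto
      then show ?thesis
        using Cauchy_Schwarz_ineq2[of g "e j"] norm_e[of j] j by simp
    qed
    have "y \<bullet> e j \<in> {-1..1}" if "j \<in> {1..?d}" for j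
      using Cauchy_Schwarz_ineq2[of y "e j"] norm_e[OF that] True by (auto simp: abs_le_iff)
    then have "(\<Prod>j=1..?d. f j (y \<bullet> e j)) =
        (\<Prod>j=1..?d. if j \<le> m then 1 else epowr \<bar>y \<bullet> e j\<bar> (\<beta> / real (?d - m)))"
      by (intro prod.cong) (auto simp: f_def)
    also have "\<dots> = (\<Prod>j=m+1..?d. epowr \<bar>y \<bullet> e j\<bar> (\<beta> / real (?d - m)))"
      by (intro prod.mono_neutral_cong_right) auto
    also have "\<dots> \<ge> epowr (norm g) \<beta>"
      using epowr_norm_le_prod[of "{m+1..?d}" \<beta> "\<lambda>j. y \<bullet> e j" g] \<beta> m y_e by simp
    finally show ?thesis
      using True by (simp add: g_def)
  qed auto
  then have "(\<integral>\<^sup>+y. epowr (norm (gs (x(Suc m := y)) (Suc m))) \<beta> * indicator (cball 0 1) y \<partial>lborel)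
      \<le> (\<integral>\<^sup>+y. (\<Prod>j=1..?d. f j (y \<bullet> e j)) \<partial>lborel)"
    by (intro nn_integral_mono)
  also have "\<dots> = (\<Prod>j=1..?d. \<integral>\<^sup>+t. f j t \<partial>lborel)"
  proof (rule nn_integral_lborel_frame_prod[OF e(1)])
    show "f j \<in> borel_measurable borel" for j
      unfolding f_def by measurable
  qed
  also have "\<dots> = (\<Prod>j=1..m. \<integral>\<^sup>+t. f j t \<partial>lborel) * (\<Prod>j=m+1..?d. \<integral>\<^sup>+t. f j t \<partial>lborel)"
    using m by (subst prod.union_disjoint[symmetric]) (auto intro!: prod.cong)
  also have "(\<Prod>j=1..m. \<integral>\<^sup>+t. f j t \<partial>lborel) = 2 ^ m"
    by (simp add: f_def)
  also have "(\<Prod>j=m+1..?d. \<integral>\<^sup>+t. f j t \<partial>lborel) =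
      (\<integral>\<^sup>+t. epowr \<bar>t\<bar> (\<beta> / real (?d - m)) * indicator {-1..1} t \<partial>lborel) ^ (?d - m)"
    using m by (simp add: f_def of_nat_diff)
  finally show ?thesis
    unfolding slice_bound_def .
qed

lemma gs_factor_measurable:
  assumes "j \<in> {1..k}"
  shows "(\<lambda>x. epowr (norm (gs x j)) \<beta> * indicator (cball 0 1) (x j))
    \<in> borel_measurable (\<Pi>\<^sub>M l\<in>{1..k}. (lborel :: 'a::euclidean_space measure))"
    (is "_ \<in> borel_measurable ?P")
proof -
  have x_meas: "(\<lambda>x. x j) \<in> ?P \<rightarrow>\<^sub>M (borel :: 'a measure)"
    using measurable_component_singleton[OF assms, of "\<lambda>_. lborel :: 'a measure"] by simp
  have gs_meas: "(\<lambda>x. gs x j) \<in> ?P \<rightarrow>\<^sub>M (borel :: 'a measure)"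
    using assms by (intro gs_measurable) auto
  have "(\<lambda>v :: 'a. epowr (norm v) \<beta>) \<in> borel_measurable borel"
    by measurable
  moreover have "(\<lambda>v :: 'a. indicator (cball 0 1) v :: ennreal) \<in> borel_measurable borel"
    by (intro borel_measurable_indicator) simp
  ultimately show ?thesis
    by (intro borel_measurable_times_ennreal measurable_compose[OF gs_meas] measurable_compose[OF x_meas])
qed

text \<open>Induction on the number of points, integrating the last one first. Point number j needs
  \<beta> > - (d - j + 1), which is strongest for j = k; there it is the assumed bound, so the
  hypothesis passes to fewer points.\<close>

lemma nn_integral_gs_finite:
  assumes "k \<le> CARD('n)" "\<beta> \<le> 0" "\<beta> > - real CARD('n) + real k - 1"
  shows "(\<integral>\<^sup>+x. (\<Prod>j=1..k. epowr (norm (gs x j)) \<beta> * indicator (cball 0 1) (x j))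
      \<partial>(\<Pi>\<^sub>M l\<in>{1..k}. (lborel :: (real ^ 'n) measure))) < \<infinity>"
  using assms
proof (induction k)
  case 0
  show ?case
    by (simp add: PiM_empty)
next
  case (Suc k)
  interpret product_sigma_finite "\<lambda>_. lborel :: (real ^ 'n) measure"
    by (simp add: product_sigma_finite_def lborel.sigma_finite_measure_axioms)
  let ?h = "\<lambda>x :: nat \<Rightarrow> real ^ 'n. \<lambda>j. epowr (norm (gs x j)) \<beta> * indicator (cball 0 1) (x j)"
  let ?P = "\<lambda>k. \<Pi>\<^sub>M l\<in>{1..k}. (lborel :: (real ^ 'n) measure)"
  have ins: "{1..Suc k} = insert (Suc k) {1..k}"
    by auto
  note h_meas = gs_factor_measurable[where 'a = "real ^ 'n" and \<beta> = \<beta>]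
  have "(\<integral>\<^sup>+x. (\<Prod>j=1..Suc k. ?h x j) \<partial>?P (Suc k)) =
      (\<integral>\<^sup>+x. \<integral>\<^sup>+y. (\<Prod>j=1..Suc k. ?h (x(Suc k := y)) j) \<partial>lborel \<partial>?P k)"
    unfolding ins
    by (rule product_nn_integral_insert) (use h_meas[of _ "Suc k"] in \<open>auto simp: ins intro!: borel_measurable_prod_ennreal\<close>)
  \<comment> \<open>The first k factors do not depend on the last point.\<close>
  also have "\<dots> = (\<integral>\<^sup>+x. (\<Prod>j=1..k. ?h x j) * (\<integral>\<^sup>+y. ?h (x(Suc k := y)) (Suc k) \<partial>lborel) \<partial>?P k)"
  proof (intro nn_integral_cong)
    fix x assume x: "x \<in> space (?P k)"
    have "(\<lambda>y. x(Suc k := y)) \<in> lborel \<rightarrow>\<^sub>M ?P (Suc k)"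
      unfolding ins using x by (intro measurable_component_update) auto
    from measurable_compose[OF this h_meas[of "Suc k" "Suc k"]]
    have meas: "(\<lambda>y. ?h (x(Suc k := y)) (Suc k)) \<in> borel_measurable lborel"
      by simp
    have "(\<Prod>j=1..Suc k. ?h (x(Suc k := y)) j) = (\<Prod>j=1..k. ?h x j) * ?h (x(Suc k := y)) (Suc k)" for y
    proof -
      have "?h (x(Suc k := y)) j = ?h x j" if "j \<in> {1..k}" for j
        using that gs_cong[of j "x(Suc k := y)" x] by auto
      then show ?thesis
        unfolding ins by (subst prod.insert) (auto simp: mult.commute)
    qed
    then show "(\<integral>\<^sup>+y. (\<Prod>j=1..Suc k. ?h (x(Suc k := y)) j) \<partial>lborel) =
        (\<Prod>j=1..k. ?h x j) * (\<integral>\<^sup>+y. ?h (x(Suc k := y)) (Suc k) \<partial>lborel)"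
      using meas by (simp only: nn_integral_cmult)
  qed
  also have "\<dots> \<le> (\<integral>\<^sup>+x. (\<Prod>j=1..k. ?h x j) * slice_bound CARD('n) k \<beta> \<partial>?P k)"
  proof (intro nn_integral_mono mult_left_mono)
    have "k < CARD('n)"
      using Suc.prems(1) by simp
    from nn_integral_gs_slice[OF this Suc.prems(2)]
    show "(\<integral>\<^sup>+y. ?h (x(Suc k := y)) (Suc k) \<partial>lborel) \<le> slice_bound CARD('n) k \<beta>" for x
      by (simp only: fun_upd_same)
  qed simp
  also have "\<dots> = (\<integral>\<^sup>+x. (\<Prod>j=1..k. ?h x j) \<partial>?P k) * slice_bound CARD('n) k \<beta>"
    using h_meas[of _ k] by (intro nn_integral_multc borel_measurable_prod_ennreal) auto
  also have "\<dots> < \<infinity>"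
    using Suc slice_bound_finite[of k "CARD('n)" \<beta>] by (simp add: ennreal_mult_less_top of_nat_diff)
  finally show ?case .
qed

section \<open>The moments of simplex volumes\<close>

lemma set_simplex_list: "set (0 # map x [1..<k + 1]) = insert 0 (x ` {1..k})"
  by (auto simp: image_iff)

lemma short_edges_simplex_iff:
  fixes x :: "nat \<Rightarrow> 'a::euclidean_space"
  shows "short_edges 1 (0 # map x [1..<k + 1]) \<longleftrightarrow>
    (\<forall>i\<in>{1..k}. norm (x i) \<le> 1) \<and> (\<forall>i\<in>{1..k}. \<forall>j\<in>{1..k}. norm (x i - x j) \<le> 1)"
  unfolding short_edges_def set_simplex_list by (auto simp: norm_minus_commute)

definition simplex_weight :: "nat \<Rightarrow> real \<Rightarrow> (nat \<Rightarrow> real ^ 'n) \<Rightarrow> real" where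
  "simplex_weight k \<alpha> x = indicator (ball_power k) x * Delta_pow 1 \<alpha> (0 # map x [1..<k + 1])"

lemma simplex_weight_nonneg: "0 \<le> simplex_weight k \<alpha> x"
  by (simp add: simplex_weight_def Delta_pow_def)

lemma Delta_pow_simplex:
  fixes x :: "nat \<Rightarrow> real ^ 'n"
  assumes "short_edges 1 (0 # map x [1..<k + 1])"
  shows "Delta_pow 1 \<alpha> (0 # map x [1..<k + 1]) =
    (if \<alpha> = 0 then 1
     else if k \<le> CARD('n) then (kappa k CARD('n) * (\<Prod>j=1..k. norm (gs x j))) powr \<alpha> else 1)"
proof -
  have "length (0 # map x [1..<k + 1]) - 1 = k"
    by simp
  then have "Delta 1 (0 # map x [1..<k + 1]) =
      (if k \<le> CARD('n) then kappa k CARD('n) * (\<Prod>j=1..k. norm (gs x j)) else 1)"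
    using assms flat_volume_simplex[of k x] unfolding Delta_def set_simplex_list Let_def by simp
  then show ?thesis
    using assms by (simp add: Delta_pow_def)
qed

lemma ball_power_sets:
  "ball_power k \<in> sets (\<Pi>\<^sub>M l\<in>{1..k}. (lborel :: 'a::euclidean_space measure))"
  unfolding ball_power_def by (intro sets_PiM_I_finite) auto

text \<open>The definition through \<open>SOME\<close> gives no measurability. It comes from the
  closed formula on the set of short edges, where the weight is a power of a measurable product of
  Gram--Schmidt norms or the constant 1.\<close>

lemma simplex_weight_measurable:
  "simplex_weight k \<alpha> \<in> borel_measurable (\<Pi>\<^sub>M l\<in>{1..k}. (lborel :: (real ^ 'n) measure))"
    (is "_ \<in> borel_measurable ?P")
proof -
  let ?short = "\<lambda>x :: nat \<Rightarrow> real ^ 'n. short_edges 1 (0 # map x [1..<k + 1])"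
  have comp: "(\<lambda>x. x j) \<in> ?P \<rightarrow>\<^sub>M (borel :: (real ^ 'n) measure)" if "j \<in> {1..k}" for j
    using measurable_component_singleton[OF that, of "\<lambda>_. lborel :: (real ^ 'n) measure"] by simp
  have gs: "(\<lambda>x. gs x j) \<in> ?P \<rightarrow>\<^sub>M (borel :: (real ^ 'n) measure)" if "j \<in> {1..k}" for j
    using that by (intro gs_measurable) auto
  have "{x \<in> space ?P. ?short x} \<in> sets ?P"
    unfolding short_edges_simplex_iff
    by (intro sets.sets_Collect_conj sets.sets_Collect_finite_All borel_measurable_le
        borel_measurable_norm borel_measurable_diff comp) auto
  moreover have "(\<lambda>x. (kappa k CARD('n) * (\<Prod>j=1..k. norm (gs x j))) powr \<alpha>) \<in> borel_measurable ?P"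
    by (intro powr_real_measurable borel_measurable_times borel_measurable_prod
        measurable_compose[OF gs borel_measurable_norm]) auto
  ultimately have "(\<lambda>x. indicator (ball_power k) x * (if ?short x then if \<alpha> = 0 then 1
      else if k \<le> CARD('n) then (kappa k CARD('n) * (\<Prod>j=1..k. norm (gs x j))) powr \<alpha> else 1
      else 0) :: real) \<in> borel_measurable ?P"
    using ball_power_sets[where 'a = "real ^ 'n", of k]
    by (intro borel_measurable_times borel_measurable_indicator measurable_If) (auto split: if_splits)
  moreover have "simplex_weight k \<alpha> = (\<lambda>x :: nat \<Rightarrow> real ^ 'n. indicator (ball_power k) x * (if ?short x then if \<alpha> = 0 then 1
      else if k \<le> CARD('n) then (kappa k CARD('n) * (\<Prod>j=1..k. norm (gs x j))) powr \<alpha> else 1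
      else 0))"
  proof
    show "simplex_weight k \<alpha> x = indicator (ball_power k) x * (if ?short x then if \<alpha> = 0 then 1
      else if k \<le> CARD('n) then (kappa k CARD('n) * (\<Prod>j=1..k. norm (gs x j))) powr \<alpha> else 1
      else 0)" for x :: "nat \<Rightarrow> real ^ 'n"
    proof (cases "?short x")
      case True
      then show ?thesis
        unfolding simplex_weight_def by (simp only: Delta_pow_simplex if_True)
    qed (simp add: simplex_weight_def Delta_pow_def)
  qed
  ultimately show ?thesis
    by simp
qed

section \<open>Moments as nonnegative integrals and their factorisation\<close>

lemma mu_eq_nn_integral:
  "mu TYPE(real ^ 'n) k \<alpha> =
    enn2real (\<integral>\<^sup>+x. simplex_weight k \<alpha> x \<partial>(\<Pi>\<^sub>M l\<in>{1..k}. (lborel :: (real ^ 'n) measure)))"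
proof -
  have "mu TYPE(real ^ 'n) k \<alpha> =
      (\<integral>x. simplex_weight k \<alpha> x \<partial>(\<Pi>\<^sub>M l\<in>{1..k}. (lborel :: (real ^ 'n) measure)))"
    by (simp add: mu_def set_lebesgue_integral_def simplex_weight_def)
  also have "\<dots> = enn2real (\<integral>\<^sup>+x. simplex_weight k \<alpha> x \<partial>(\<Pi>\<^sub>M l\<in>{1..k}. (lborel :: (real ^ 'n) measure)))"
    \<comment> \<open>Integrability is not presupposed: \<open>enn2real\<close> maps \<infinity> to
      0, which is also the value of the Bochner integral of a nonintegrable function.\<close>
    by (rule integral_eq_nn_integral[OF simplex_weight_measurable]) (simp add: simplex_weight_nonneg)
  finally show ?thesis .
qed

text \<open>The offset i selects a block of consecutive coordinates: 0 for the first simplex,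
  \<open>k\<^sub>1\<close> for the second.\<close>

lemma simplex_weight_restrict:
  fixes x :: "nat \<Rightarrow> real ^ 'n"
  shows "simplex_weight k \<alpha> (\<lambda>j\<in>{1..k}. x (i + j)) =
    (if \<forall>j\<in>{1..k}. x (i + j) \<in> cball 0 1
     then Delta_pow 1 \<alpha> (0 # map x [i + 1..<i + k + 1]) else 0)"
proof -
  have "map (\<lambda>j\<in>{1..k}. x (i + j)) [1..<k + 1] = map x [i + 1..<i + k + 1]"
    by (rule nth_equalityI) (auto simp: add.assoc)
  moreover have "(\<lambda>j\<in>{1..k}. x (i + j)) \<in> ball_power k \<longleftrightarrow> (\<forall>j\<in>{1..k}. x (i + j) \<in> cball 0 1)"
    unfolding ball_power_def PiE_iff by (simp add: Ball_def cong: conj_cong imp_cong)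
  ultimately show ?thesis
    by (simp add: simplex_weight_def)
qed

text \<open>Apart from the common vertex 0, the two simplices use disjoint blocks of coordinates.
  Since the weight is nonnegative, Tonelli separates the blocks without integrability, and the
  second block is shifted back to start at 1.\<close>

lemma mu2_eq_mult:
  "mu2 TYPE(real ^ 'n) k\<^sub>1 k\<^sub>2 1 \<alpha>\<^sub>1 \<alpha>\<^sub>2 = mu TYPE(real ^ 'n) k\<^sub>1 \<alpha>\<^sub>1 * mu TYPE(real ^ 'n) k\<^sub>2 \<alpha>\<^sub>2"
proof -
  let ?L = "\<lambda>I. \<Pi>\<^sub>M l\<in>I. (lborel :: (real ^ 'n) measure)"
  let ?I = "{1..k\<^sub>1}" and ?J = "{k\<^sub>1 + 1..k\<^sub>1 + k\<^sub>2}"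
  interpret product_sigma_finite "\<lambda>_. lborel :: (real ^ 'n) measure"
    by (simp add: product_sigma_finite_def lborel.sigma_finite_measure_axioms)
  define r\<^sub>1 :: "(nat \<Rightarrow> real ^ 'n) \<Rightarrow> nat \<Rightarrow> real ^ 'n" where "r\<^sub>1 x = (\<lambda>j\<in>{1..k\<^sub>1}. x (0 + j))" for x
  define r\<^sub>2 :: "(nat \<Rightarrow> real ^ 'n) \<Rightarrow> nat \<Rightarrow> real ^ 'n" where "r\<^sub>2 x = (\<lambda>j\<in>{1..k\<^sub>2}. x (k\<^sub>1 + j))" for x
  have r1: "r\<^sub>1 \<in> ?L {1..k\<^sub>1 + k\<^sub>2} \<rightarrow>\<^sub>M ?L {1..k\<^sub>1}"
    unfolding r\<^sub>1_def[abs_def] by (intro measurable_restrict measurable_component_singleton) auto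
  have r2: "r\<^sub>2 \<in> ?L {1..k\<^sub>1 + k\<^sub>2} \<rightarrow>\<^sub>M ?L {1..k\<^sub>2}"
    unfolding r\<^sub>2_def[abs_def] by (intro measurable_restrict measurable_component_singleton) auto
  have r2': "r\<^sub>2 \<in> ?L ?J \<rightarrow>\<^sub>M ?L {1..k\<^sub>2}"
    unfolding r\<^sub>2_def[abs_def] by (intro measurable_restrict measurable_component_singleton) auto
  note w1 = simplex_weight_measurable[where 'n = 'n, of k\<^sub>1 \<alpha>\<^sub>1]
  note w2 = simplex_weight_measurable[where 'n = 'n, of k\<^sub>2 \<alpha>\<^sub>2]
  have factor: "indicator (ball_power (k\<^sub>1 + k\<^sub>2)) x *
      (Delta_pow 1 \<alpha>\<^sub>1 (0 # map x [1..<k\<^sub>1 + 1]) * Delta_pow 1 \<alpha>\<^sub>2 (0 # map x [k\<^sub>1 + 1..<k\<^sub>1 + k\<^sub>2 + 1])) =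
      simplex_weight k\<^sub>1 \<alpha>\<^sub>1 (r\<^sub>1 x) * simplex_weight k\<^sub>2 \<alpha>\<^sub>2 (r\<^sub>2 x)"
    if x: "x \<in> space (?L {1..k\<^sub>1 + k\<^sub>2})" for x
  proof -
    have "x \<in> ball_power (k\<^sub>1 + k\<^sub>2) \<longleftrightarrow> (\<forall>j\<in>{1..k\<^sub>1 + k\<^sub>2}. x j \<in> cball 0 1)"
      using x by (simp add: ball_power_def space_PiM PiE_iff)
    also have "\<dots> \<longleftrightarrow> (\<forall>j\<in>{1..k\<^sub>1}. x (0 + j) \<in> cball 0 1) \<and> (\<forall>j\<in>{1..k\<^sub>2}. x (k\<^sub>1 + j) \<in> cball 0 1)"
    proof -
      have "{1..k\<^sub>1 + k\<^sub>2} = {1..k\<^sub>1} \<union> (+) k\<^sub>1 ` {1..k\<^sub>2}"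
        by (auto simp: image_add_atLeastAtMost)
      then show ?thesis
        by (simp only: ball_Un ball_simps(9)) simp
    qed
    finally show ?thesis
      using simplex_weight_restrict[of k\<^sub>1 \<alpha>\<^sub>1 x 0] simplex_weight_restrict[of k\<^sub>2 \<alpha>\<^sub>2 x k\<^sub>1]
      by (simp add: r\<^sub>1_def r\<^sub>2_def)
  qed
  have meas: "(\<lambda>x. simplex_weight k\<^sub>1 \<alpha>\<^sub>1 (r\<^sub>1 x)) \<in> borel_measurable (?L {1..k\<^sub>1 + k\<^sub>2})"
    "(\<lambda>x. simplex_weight k\<^sub>2 \<alpha>\<^sub>2 (r\<^sub>2 x)) \<in> borel_measurable (?L {1..k\<^sub>1 + k\<^sub>2})"
    "(\<lambda>x. simplex_weight k\<^sub>2 \<alpha>\<^sub>2 (r\<^sub>2 x)) \<in> borel_measurable (?L ?J)"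
    using measurable_compose[OF r1 w1] measurable_compose[OF r2 w2] measurable_compose[OF r2' w2]
    by simp_all
  have "mu2 TYPE(real ^ 'n) k\<^sub>1 k\<^sub>2 1 \<alpha>\<^sub>1 \<alpha>\<^sub>2 =
      (\<integral>x. simplex_weight k\<^sub>1 \<alpha>\<^sub>1 (r\<^sub>1 x) * simplex_weight k\<^sub>2 \<alpha>\<^sub>2 (r\<^sub>2 x) \<partial>?L {1..k\<^sub>1 + k\<^sub>2})"
  proof -
    \<comment> \<open>For m = 1 the second list starts immediately after the first one ends.\<close>
    have "k\<^sub>1 + k\<^sub>2 + 1 - 1 = k\<^sub>1 + k\<^sub>2" "k\<^sub>1 + 2 - 1 = k\<^sub>1 + 1"
      by simp_all
    then show ?thesis
      unfolding mu2_def set_lebesgue_integral_def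
      by (simp only: real_scaleR_def) (intro Bochner_Integration.integral_cong refl factor)
  qed
  also have "\<dots> = enn2real (\<integral>\<^sup>+x. ennreal (simplex_weight k\<^sub>1 \<alpha>\<^sub>1 (r\<^sub>1 x) * simplex_weight k\<^sub>2 \<alpha>\<^sub>2 (r\<^sub>2 x))
      \<partial>?L {1..k\<^sub>1 + k\<^sub>2})"
    using meas by (intro integral_eq_nn_integral) (auto simp: simplex_weight_nonneg)
  also have "(\<integral>\<^sup>+x. ennreal (simplex_weight k\<^sub>1 \<alpha>\<^sub>1 (r\<^sub>1 x) * simplex_weight k\<^sub>2 \<alpha>\<^sub>2 (r\<^sub>2 x)) \<partial>?L {1..k\<^sub>1 + k\<^sub>2}) =
      (\<integral>\<^sup>+a. \<integral>\<^sup>+b. ennreal (simplex_weight k\<^sub>1 \<alpha>\<^sub>1 (r\<^sub>1 (merge ?I ?J (a, b))) *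
        simplex_weight k\<^sub>2 \<alpha>\<^sub>2 (r\<^sub>2 (merge ?I ?J (a, b)))) \<partial>?L ?J \<partial>?L ?I)"
  proof -
    have un: "{1..k\<^sub>1 + k\<^sub>2} = ?I \<union> ?J" and disj: "?I \<inter> ?J = {}"
      by auto
    show ?thesis
      using meas unfolding un by (intro product_nn_integral_fold[OF disj]) auto
  qed
  also have "\<dots> = (\<integral>\<^sup>+a. \<integral>\<^sup>+b. ennreal (simplex_weight k\<^sub>1 \<alpha>\<^sub>1 a) * ennreal (simplex_weight k\<^sub>2 \<alpha>\<^sub>2 (r\<^sub>2 b)) \<partial>?L ?J \<partial>?L ?I)"
  proof (intro nn_integral_cong)
    fix a b assume a: "a \<in> space (?L ?I)"
    have "r\<^sub>1 (merge ?I ?J (a, b)) = a"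
      using a by (auto simp: r\<^sub>1_def merge_def space_PiM PiE_iff extensional_def fun_eq_iff)
    moreover have "r\<^sub>2 (merge ?I ?J (a, b)) = r\<^sub>2 b"
      by (auto simp: r\<^sub>2_def merge_def fun_eq_iff)
    ultimately show "ennreal (simplex_weight k\<^sub>1 \<alpha>\<^sub>1 (r\<^sub>1 (merge ?I ?J (a, b))) *
        simplex_weight k\<^sub>2 \<alpha>\<^sub>2 (r\<^sub>2 (merge ?I ?J (a, b)))) =
        ennreal (simplex_weight k\<^sub>1 \<alpha>\<^sub>1 a) * ennreal (simplex_weight k\<^sub>2 \<alpha>\<^sub>2 (r\<^sub>2 b))"
      by (simp add: ennreal_mult simplex_weight_nonneg)
  qed
  also have "\<dots> = (\<integral>\<^sup>+a. simplex_weight k\<^sub>1 \<alpha>\<^sub>1 a \<partial>?L ?I) * (\<integral>\<^sup>+b. simplex_weight k\<^sub>2 \<alpha>\<^sub>2 (r\<^sub>2 b) \<partial>?L ?J)"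
    using meas w1 by (simp add: nn_integral_cmult nn_integral_multc)
  also have "(\<integral>\<^sup>+b. simplex_weight k\<^sub>2 \<alpha>\<^sub>2 (r\<^sub>2 b) \<partial>?L ?J) = (\<integral>\<^sup>+b. simplex_weight k\<^sub>2 \<alpha>\<^sub>2 b \<partial>?L {1..k\<^sub>2})"
  proof -
    have "bij_betw ((+) k\<^sub>1) {1..k\<^sub>2} ?J"
      by (simp add: bij_betw_def image_add_atLeastAtMost)
    then have "distr (?L ?J) (?L {1..k\<^sub>2}) r\<^sub>2 = ?L {1..k\<^sub>2}"
      unfolding r\<^sub>2_def[abs_def]
      by (rule PiM_reindex) (simp_all add: lborel.sigma_finite_measure_axioms)
    then show ?thesis
      using nn_integral_distr[OF r2', of "\<lambda>b. ennreal (simplex_weight k\<^sub>2 \<alpha>\<^sub>2 b)"] w2 by simp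
  qed
  \<comment> \<open>\<open>enn2real\<close> is multiplicative also when a factor is infinite, so the
    factorisation holds for divergent moments too.\<close>
  finally show ?thesis
    by (simp add: mu_eq_nn_integral enn2real_mult)
qed

section \<open>Finiteness and positivity of the moments\<close>

lemma nn_integral_simplex_weight_finite:
  assumes \<alpha>: "\<alpha> > - real CARD('n) + real k - 1" and large: "k > CARD('n) \<Longrightarrow> \<alpha> = 0"
  shows "(\<integral>\<^sup>+x. simplex_weight k \<alpha> x \<partial>(\<Pi>\<^sub>M l\<in>{1..k}. (lborel :: (real ^ 'n) measure))) < \<infinity>"
    (is "integral\<^sup>N ?P _ < _")
proof (cases "\<alpha> \<ge> 0")
  case True
  interpret product_sigma_finite "\<lambda>_. lborel :: (real ^ 'n) measure"
    by (simp add: product_sigma_finite_def lborel.sigma_finite_measure_axioms)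
  \<comment> \<open>For \<alpha> = 0 the weight is at most 1 by convention. For \<alpha> > 0 the
    case k > d is excluded, and Gram--Schmidt norms of points in the unit ball are at most 1, so
    only the constant \<open>kappa\<close> remains.\<close>
  define C where "C = (if \<alpha> = 0 then 1 else kappa k CARD('n) powr \<alpha>)"
  have "simplex_weight k \<alpha> x \<le> C * indicator (ball_power k) x" for x :: "nat \<Rightarrow> real ^ 'n"
  proof (cases "x \<in> ball_power k \<and> short_edges 1 (0 # map x [1..<k + 1])")
    case x: True
    have "(kappa k CARD('n) * (\<Prod>j=1..k. norm (gs x j))) powr \<alpha> \<le> kappa k CARD('n) powr \<alpha>"
      if "k \<le> CARD('n)"
    proof -
      have "norm (gs x j) \<le> 1" if "j \<in> {1..k}" for j
        using norm_gs_le[of x j] x that by (force simp: ball_power_def PiE_iff)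
      then have "(\<Prod>j=1..k. norm (gs x j)) \<le> 1"
        by (intro prod_le_1) auto
      then have "kappa k CARD('n) * (\<Prod>j=1..k. norm (gs x j)) \<le> kappa k CARD('n)"
        using kappa_pos[OF that] by (simp add: mult_left_le)
      then show ?thesis
        using True kappa_pos[OF that] by (intro powr_mono2) (auto intro!: mult_nonneg_nonneg prod_nonneg)
    qed
    then show ?thesis
      using x large Delta_pow_simplex[of x k \<alpha>] by (auto simp: simplex_weight_def C_def)
  next
    case False
    then show ?thesis
      by (auto simp: simplex_weight_def Delta_pow_def C_def)
  qed
  then have "(\<integral>\<^sup>+x. simplex_weight k \<alpha> x \<partial>?P) \<le> (\<integral>\<^sup>+x. ennreal (C * indicator (ball_power k) x) \<partial>?P)"
    by (intro nn_integral_mono ennreal_leI)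
  also have "\<dots> = (\<integral>\<^sup>+x. ennreal C * indicator (ball_power k) x \<partial>?P)"
    by (intro nn_integral_cong) (simp add: indicator_def)
  also have "\<dots> = ennreal C * emeasure ?P (ball_power k)"
    by (rule nn_integral_cmult_indicator[OF ball_power_sets])
  also have "emeasure ?P (ball_power k) = (\<Prod>l\<in>{1..k}. emeasure lborel (cball 0 1 :: (real ^ 'n) set))"
    unfolding ball_power_def by (intro emeasure_PiM) auto
  also have "ennreal C * \<dots> < \<infinity>"
    using emeasure_compact_finite[of "cball 0 1 :: (real ^ 'n) set"]
    by (simp add: ennreal_mult_less_top power_less_top_ennreal)
  finally show ?thesis .
next
  case False
  then have k: "k \<le> CARD('n)"
    using large by force
  \<comment> \<open>Dropping the condition on the edges between the points leaves a product of one
    factor per Gram--Schmidt vector.\<close>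
  have "ennreal (simplex_weight k \<alpha> x) \<le> ennreal (kappa k CARD('n) powr \<alpha>) *
      (\<Prod>j=1..k. epowr (norm (gs x j)) \<alpha> * indicator (cball 0 1) (x j))" for x :: "nat \<Rightarrow> real ^ 'n"
  proof (cases "x \<in> ball_power k \<and> short_edges 1 (0 # map x [1..<k + 1])")
    case x: True
    have "ennreal (simplex_weight k \<alpha> x) =
        ennreal (kappa k CARD('n) powr \<alpha>) * (\<Prod>j=1..k. ennreal (norm (gs x j) powr \<alpha>))"
      using x Delta_pow_simplex[of x k \<alpha>] False k
      by (simp add: simplex_weight_def powr_mult prod_powr_distrib prod_ennreal ennreal_mult' prod_nonneg)
    also have "\<dots> \<le> ennreal (kappa k CARD('n) powr \<alpha>) *
        (\<Prod>j=1..k. epowr (norm (gs x j)) \<alpha> * indicator (cball 0 1) (x j))"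
      using x by (intro mult_left_mono prod_mono_ennreal)
        (auto simp: epowr_def ball_power_def PiE_iff)
    finally show ?thesis .
  next
    case False
    then have "simplex_weight k \<alpha> x = 0"
      by (auto simp: simplex_weight_def Delta_pow_def)
    then show ?thesis
      by simp
  qed
  then have "(\<integral>\<^sup>+x. simplex_weight k \<alpha> x \<partial>?P) \<le> (\<integral>\<^sup>+x. ennreal (kappa k CARD('n) powr \<alpha>) *
      (\<Prod>j=1..k. epowr (norm (gs x j)) \<alpha> * indicator (cball 0 1) (x j)) \<partial>?P)"
    by (intro nn_integral_mono)
  also have "\<dots> = ennreal (kappa k CARD('n) powr \<alpha>) *
      (\<integral>\<^sup>+x. (\<Prod>j=1..k. epowr (norm (gs x j)) \<alpha> * indicator (cball 0 1) (x j)) \<partial>?P)"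
    by (intro nn_integral_cmult borel_measurable_prod_ennreal gs_factor_measurable)
  also have "\<dots> < \<infinity>"
    using nn_integral_gs_finite[OF k _ \<alpha>] False by (simp add: ennreal_mult_less_top)
  finally show ?thesis .
qed

text \<open>A finite integral forces a finite integrand almost everywhere, and \<open>epowr\<close>
  is infinite exactly where a Gram--Schmidt vector vanishes.\<close>

lemma AE_gs_nonzero:
  assumes "k \<le> CARD('n)"
  shows "AE x in (\<Pi>\<^sub>M l\<in>{1..k}. (lborel :: (real ^ 'n) measure)).
    x \<in> ball_power k \<longrightarrow> (\<forall>j\<in>{1..k}. gs x j \<noteq> 0)"
proof -
  \<comment> \<open>The exponent -1/2 exceeds -1 and hence the threshold - d + k - 1 for every k
    \<le> d.\<close>
  let ?h = "\<lambda>x :: nat \<Rightarrow> real ^ 'n. \<Prod>j=1..k. epowr (norm (gs x j)) (- 1 / 2) * indicator (cball 0 1) (x j)"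
  have "(\<integral>\<^sup>+x. ?h x \<partial>(\<Pi>\<^sub>M l\<in>{1..k}. (lborel :: (real ^ 'n) measure))) \<noteq> \<infinity>"
    using nn_integral_gs_finite[OF assms, of "- 1 / 2"] assms by simp
  then have "AE x in (\<Pi>\<^sub>M l\<in>{1..k}. (lborel :: (real ^ 'n) measure)). ?h x \<noteq> \<infinity>"
    by (intro nn_integral_noteq_infinite borel_measurable_prod_ennreal gs_factor_measurable)
  then show ?thesis
  proof eventually_elim
    case (elim x)
    show ?case
    proof (intro impI ballI notI)
      fix j assume x: "x \<in> ball_power k" and j: "j \<in> {1..k}" "gs x j = 0"
      have "?h x = (\<Prod>j=1..k. epowr (norm (gs x j)) (- 1 / 2))"
        using x by (intro prod.cong) (auto simp: ball_power_def PiE_iff)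
      also have "\<dots> = \<infinity>"
        using j epowr_neq_0[of "norm (gs x _)"]
        by (auto simp: infinity_ennreal_def ennreal_prod_eq_top epowr_def)
      finally show False
        using elim by simp
    qed
  qed
qed

lemma nn_integral_simplex_weight_pos:
  assumes large: "k > CARD('n) \<Longrightarrow> \<alpha> = 0"
  shows "(\<integral>\<^sup>+x. simplex_weight k \<alpha> x \<partial>(\<Pi>\<^sub>M l\<in>{1..k}. (lborel :: (real ^ 'n) measure))) \<noteq> 0"
    (is "integral\<^sup>N ?P _ \<noteq> _")
proof
  interpret product_sigma_finite "\<lambda>_. lborel :: (real ^ 'n) measure"
    by (simp add: product_sigma_finite_def lborel.sigma_finite_measure_axioms)
  \<comment> \<open>With radius 1/2 the triangle inequality makes all edges at most 1. On this set
    of positive measure the weight is positive, except on a null set of degenerate simplices when k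
    \<le> d.\<close>
  let ?small = "\<Pi>\<^sub>E l\<in>{1..k}. (cball 0 (1 / 2) :: (real ^ 'n) set)"
  have small_sets: "?small \<in> sets ?P"
    by (intro sets_PiM_I_finite) auto
  have pos: "simplex_weight k \<alpha> x > 0"
    if x: "x \<in> ?small" and nz: "k \<le> CARD('n) \<Longrightarrow> \<forall>j\<in>{1..k}. gs x j \<noteq> 0" for x
  proof -
    have half: "norm (x j) \<le> 1 / 2" if "j \<in> {1..k}" for j
      using PiE_mem[OF x that] by simp
    have ball: "x \<in> ball_power k"
      using x half by (force simp: ball_power_def PiE_iff)
    have "norm (x i - x j) \<le> 1" if "i \<in> {1..k}" "j \<in> {1..k}" for i j
      using norm_triangle_ineq4[of "x i" "x j"] half[OF that(1)] half[OF that(2)] by simp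
    then have short: "short_edges 1 (0 # map x [1..<k + 1])"
      unfolding short_edges_simplex_iff using half by force
    have "kappa k CARD('n) * (\<Prod>j=1..k. norm (gs x j)) > 0" if "k \<le> CARD('n)"
      using kappa_pos[OF that] nz[OF that] by (intro mult_pos_pos prod_pos) auto
    then have "(kappa k CARD('n) * (\<Prod>j=1..k. norm (gs x j))) powr \<alpha> > 0" if "k \<le> CARD('n)"
      using that less_imp_neq by (metis powr_gt_zero)
    then have "Delta_pow 1 \<alpha> (0 # map x [1..<k + 1]) > 0"
      unfolding Delta_pow_simplex[OF short] by (auto simp del: powr_gt_zero)
    then show ?thesis
      using ball by (simp add: simplex_weight_def)
  qed
  assume "(\<integral>\<^sup>+x. simplex_weight k \<alpha> x \<partial>?P) = 0"
  then have "AE x in ?P. ennreal (simplex_weight k \<alpha> x) = 0"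
    using simplex_weight_measurable[where 'n = 'n, of k \<alpha>] by (subst (asm) nn_integral_0_iff_AE) auto
  moreover have "AE x in ?P. k \<le> CARD('n) \<longrightarrow> x \<in> ball_power k \<longrightarrow> (\<forall>j\<in>{1..k}. gs x j \<noteq> 0)"
    using AE_gs_nonzero[where 'n = 'n, of k] by (cases "k \<le> CARD('n)") auto
  ultimately have "AE x in ?P. x \<notin> ?small"
  proof eventually_elim
    case (elim x)
    have "x \<in> ball_power k" if "x \<in> ?small"
      using that by (force simp: ball_power_def PiE_iff)
    then show ?case
      using elim pos[of x] by (auto simp: ennreal_eq_0_iff)
  qed
  then have "emeasure ?P ?small = 0"
    using AE_iff_null_sets[OF small_sets] by blast
  moreover have "emeasure ?P ?small = (\<Prod>l\<in>{1..k}. emeasure lborel (cball 0 (1 / 2) :: (real ^ 'n) set))"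
    by (intro emeasure_PiM) auto
  moreover have "emeasure lborel (cball 0 (1 / 2) :: (real ^ 'n) set) \<noteq> 0"
    using content_cball_pos[of "1 / 2" "0 :: real ^ 'n"] by (auto simp: measure_def)
  ultimately show False
    by simp
qed

lemma mu_pos:
  assumes "\<alpha> > - real CARD('n) + real k - 1" "k > CARD('n) \<Longrightarrow> \<alpha> = 0"
  shows "mu TYPE(real ^ 'n) k \<alpha> > 0"
  using nn_integral_simplex_weight_finite[where 'n = 'n, OF assms]
    nn_integral_simplex_weight_pos[where 'n = 'n, OF assms(2)]
  by (simp add: mu_eq_nn_integral enn2real_positive_iff zero_less_iff_neq_zero)

theorem theorem5p1:
  fixes n :: nat and k :: "nat \<Rightarrow> nat" and \<alpha> :: "nat \<Rightarrow> real"
    and S :: "real Matrix.mat" and a :: "nat \<Rightarrow> real" and v :: "nat \<Rightarrow> real Matrix.vec"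
    and lam\<^sub>1 lam\<^sub>2 :: real
  assumes "n \<ge> 2"
    and "admissible CARD('d::finite) n k \<alpha>"
    and "S = Sigma_supercritical TYPE(real ^ 'd) n k \<alpha>"
    and "\<And>i. a i = fact (k i) / mu TYPE(real ^ 'd) (k i) (\<alpha> i)"
    and "lam\<^sub>1 = 0"
    and "lam\<^sub>2 = (\<Sum>i<n. 1 / (a i)\<^sup>2)"
    and "\<And>i. 1 \<le> i \<Longrightarrow> i \<le> n - 1 \<Longrightarrow>
           v i = Matrix.vec n (\<lambda>j. if j = 0 then a 0 / a i else if j = i then - 1 else 0)"
    and "v n = Matrix.vec n (\<lambda>j. a (n - 1) / a j)"
  shows "{l. eigenvalue S l} = {lam\<^sub>1, lam\<^sub>2} \<and>
         eigenspace S lam\<^sub>1 = vec_lin_span n {v i |i. i \<in> {1..n - 1}} \<and>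
         eigenspace S lam\<^sub>2 = vec_lin_span n {v n}"
proof -
  \<comment> \<open>The matrix is u u^T with this u, and its nonzero eigenvalue is the squared norm
    of u.\<close>
  define u where "u i = 1 / a i" for i
  have u_eq: "u i = mu TYPE(real ^ 'd) (k i) (\<alpha> i) / fact (k i)" for i
    by (simp add: u_def assms(4))
  have u: "u i \<noteq> 0" if "i < n" for i
  proof -
    have "mu TYPE(real ^ 'd) (k i) (\<alpha> i) > 0"
      using assms(2) that by (intro mu_pos) (auto simp: admissible_def)
    then show ?thesis
      by (simp add: u_eq)
  qed
  have S: "S = Matrix.mat n n (\<lambda>(i, j). u i * u j)"
    by (simp add: assms(3) Sigma_supercritical_def mu2_eq_mult u_eq)
  have lam: "lam\<^sub>2 = (\<Sum>i<n. (u i)\<^sup>2)"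
    by (simp add: assms(6) u_def power_divide)
  \<comment> \<open>Passing to reciprocals swaps numerator and denominator, which brings the given
    vectors into the form of \<open>rank_one_spectrum\<close>.\<close>
  have ratio: "a i / a j = u j / u i" for i j
    by (simp add: u_def)
  show ?thesis
    using rank_one_spectrum[OF assms(1) u assms(7)[unfolded ratio] assms(8)[unfolded ratio]]
    unfolding S[symmetric] lam[symmetric] assms(5) by blast
qed

end
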